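(* Let $f=h+\overline{g}\in\mathcal{H}ar(\mathbb{D})$ be such that $h$ is injective in $\mathbb{D}$ and $g(z)=w(z)h(z)$, where $w\in\mathcal{B}$. Then $f$ is sense-preserving and injective in $\mathbb{D}_{2-\sqrt{3}}$. The result is sharp, i.e. the constant $2-\sqrt{3}$ cannot be replaced by any larger one.
   Context: $\mathbb{D}=\{z\in\mathbb{C}:|z|<1\}$ and $\mathbb{D}_r=\{z\in\mathbb{C}:|z|<r\}$ for $0<r<1$. $\mathcal{H}ar(\mathbb{D})$ is the class of harmonic mappings $f=h+\overline{g}$ in $\mathbb{D}$, where $h$ and $g$ are analytic in $\mathbb{D}$ with $h(0)=0$, $h'(0)=1$ and $g(0)=0$ (this representation of $f$ is unique). $\mathcal{B}$ is the set of all analytic functions $w$ in $\mathbb{D}$ such that $|w(z)|\le 1$ in $\mathbb{D}$. The Jacobian of $f=h+\overline{g}$ is $J_f(z)=|h'(z)|^2-|g'(z)|^2$; $f$ is sense-preserving in a domain if $J_f>0$ there.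
   Formalization: The formal statement additionally assumes that w is not a constant of modulus 1; for such w (e.g. h(z)=z, w=1, f=2 Re z) the Jacobian vanishes identically and the claim fails, and the examples showing sharpness also satisfy this assumption. *)

theory Defs
  imports "HOL-Complex_Analysis.Complex_Analysis"
begin

abbreviation unit_disc :: "complex set" where
  "unit_disc \<equiv> ball 0 1"

text \<open>
  \<^term>\<open>Har_rep f h g\<close> says that \<^term>\<open>f\<close> is a normalized harmonic mapping of the unit disc whose
  analytic and co-analytic parts are \<^term>\<open>h\<close> and \<^term>\<open>g\<close>. The normalization determines
  \<^term>\<open>h\<close> and \<^term>\<open>g\<close> on the disc, so the Jacobian below depends there only on \<^term>\<open>f\<close>.
  Values outside the disc are irrelevant.
\<close>

definition Har_rep ::
  "(complex \<Rightarrow> complex) \<Rightarrow> (complex \<Rightarrow> complex) \<Rightarrow> (complex \<Rightarrow> complex) \<Rightarrow> bool" where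
  "Har_rep f h g \<longleftrightarrow>
     h holomorphic_on unit_disc \<and> g holomorphic_on unit_disc \<and>
     h 0 = 0 \<and> deriv h 0 = 1 \<and> g 0 = 0 \<and>
     (\<forall>z\<in>unit_disc. f z = h z + cnj (g z))"

definition harmonic_jacobian ::
  "(complex \<Rightarrow> complex) \<Rightarrow> (complex \<Rightarrow> complex) \<Rightarrow> complex \<Rightarrow> real" where
  "harmonic_jacobian h g z = (cmod (deriv h z))\<^sup>2 - (cmod (deriv g z))\<^sup>2"

definition sense_preserving_on ::
  "complex set \<Rightarrow> (complex \<Rightarrow> complex) \<Rightarrow> (complex \<Rightarrow> complex) \<Rightarrow> bool" where
  "sense_preserving_on S h g \<longleftrightarrow> (\<forall>z\<in>S. harmonic_jacobian h g z > 0)"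

definition bounded_class :: "(complex \<Rightarrow> complex) set" where
  "bounded_class = {w. w holomorphic_on unit_disc \<and> (\<forall>z\<in>unit_disc. cmod (w z) \<le> 1)}"

text \<open>
  A multiplier that is constantly \<^term>\<open>c\<close> with \<^term>\<open>cmod c = 1\<close> gives the mapping
  \<^term>\<open>\<lambda>z. h z + cnj (c * h z)\<close>, whose Jacobian vanishes identically and whose range lies
  on a real line. This degenerate case has to be excluded.
\<close>

definition unimodular_constant :: "(complex \<Rightarrow> complex) \<Rightarrow> bool" where
  "unimodular_constant w \<longleftrightarrow> (\<exists>c. cmod c = 1 \<and> (\<forall>z\<in>unit_disc. w z = c))"

end

theory Submission
  imports Defs
begin

unbundle no Formal_Power_Series.fps_syntax

text \<open>
  The number \<open>2 - sqrt 3\<close>, the smaller root of \<open>1 - 4 r + r\<^sup>2\<close>, enters twice: it is the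
  radius of convexity of injective holomorphic functions on the disc, and it is where
  \<open>r / (1 - r)\<^sup>2\<close> reaches \<open>1 / 2\<close>.

  The latter makes \<open>f\<close> sense-preserving. For injective \<open>h\<close> with \<open>h 0 = 0\<close>, the
  distortion theorem gives \<open>|h / h'| \<le> r (1 + r) / (1 - r)\<close> on the circle of radius \<open>r\<close>
  (\<open>log_derivative_bound\<close>). Together with the Schwarz-Pick inequality
  \<open>|w'| \<le> (1 - |w|\<^sup>2) / (1 - r\<^sup>2)\<close> it yields
  \<open>|g' / h'| \<le> |w| + (1 - |w|\<^sup>2) r / (1 - r)\<^sup>2\<close>, which is less than \<open>1\<close> for
  \<open>r < 2 - sqrt 3\<close> (\<open>dilatation_less_one\<close>).

  The former makes \<open>f\<close> injective. The image of the disc of radius \<open>2 - sqrt 3\<close> under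
  \<open>h\<close> is convex (\<open>radius_of_convexity\<close>). In the coordinate \<open>u = h z\<close> the mapping
  becomes \<open>u + cnj (G u)\<close> with \<open>|G'| < 1\<close> on a convex domain, and such a mapping is injective
  (\<open>harmonic_injective_of_convex\<close>).

  Both facts about \<open>h\<close> come from the inequality
  \<open>|h'' (1 - |z|\<^sup>2) - 2 cnj z h'| \<le> 4 |h'|\<close> (\<open>second_derivative_bound\<close>), which is
  Bieberbach's \<open>|F''(0)| \<le> 4 |F'(0)|\<close> for the Koebe transform of \<open>h\<close>. Bieberbach's inequality in
  turn is the first coefficient estimate of the area theorem, applied to the reciprocal of the square
  root transform (\<open>area_theorem_first_coefficient\<close>). The area theorem is proved by comparing the area of
  the image of a large annulus with that of a slightly larger ellipse. Convexity follows from the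
  positivity of \<open>1 + Re (z h'' / h')\<close> because the preimage of a segment in the image of \<open>h\<close>
  cannot have a point of maximal modulus in its interior (\<open>segment_stays_inside\<close>).

  The constant is sharp because all these estimates are attained together at a negative point by the Koebe
  function and, in the limit \<open>a \<rightarrow> 1\<close>, by the multipliers
  \<open>w z = (z - a) / (1 - a z)\<close> (\<open>sharpness\<close>).
\<close>

section \<open>Area of images under injective holomorphic maps\<close>

text \<open>
  The change of variables formula will be applied on \<open>real^2\<close>, Fubini's theorem on
  \<open>real \<times> real\<close>. The obvious bijection maps boxes to boxes of the same content and so
  transports integrals from one plane to the other.
\<close>

lemma has_integral_pair_imp_plane:
  fixes f :: "real \<times> real \<Rightarrow> real" and a b c d :: real
  assumes "(f has_integral i) (cbox (a, c) (b, d))"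
  shows "((\<lambda>x :: real^2. f (x$1, x$2)) has_integral i) (cbox (vector [a, c]) (vector [b, d]))"
proof -
  have img: "(\<lambda>x :: real^2. (x$1, x$2)) ` cbox u v = cbox (u$1, u$2) (v$1, v$2)" for u v
  proof -
    have "x \<in> (\<lambda>x :: real^2. (x$1, x$2)) ` cbox u v"
      if "x \<in> cbox (u$1, u$2) (v$1, v$2)" for x
      using that
      by (intro image_eqI[of _ _ "vector [fst x, snd x]"])
         (cases x; auto simp: mem_box_cart forall_2 cbox_Pair_eq)+
    then show ?thesis
      by (auto simp: mem_box_cart forall_2 cbox_Pair_eq)
  qed
  have img': "(\<lambda>x :: real\<times>real. vector [fst x, snd x] :: real^2) ` cbox u v
      = cbox (vector [fst u, snd u]) (vector [fst v, snd v])" for u v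
  proof -
    have "x \<in> (\<lambda>x :: real\<times>real. vector [fst x, snd x] :: real^2) ` cbox u v"
      if "x \<in> cbox (vector [fst u, snd u]) (vector [fst v, snd v])" for x
      using that
      by (intro image_eqI[of _ _ "(x$1, x$2)"])
         (cases u; cases v; auto simp: mem_box_cart forall_2 cbox_Pair_eq vec_eq_iff)+
    then show ?thesis
      by (cases u; cases v) (auto simp: mem_box_cart forall_2 cbox_Pair_eq vec_eq_iff)
  qed
  have "((\<lambda>x :: real^2. f (x$1, x$2)) has_integral (1/1) *\<^sub>R i)
     ((\<lambda>x :: real\<times>real. vector [fst x, snd x] :: real^2) ` cbox (a, c) (b, d))"
  proof (rule has_integral_twiddle[where g = "\<lambda>x :: real^2. (x$1, x$2)"])
    show "measure lborel ((\<lambda>x :: real^2. (x$1, x$2)) ` cbox u v) = 1 * measure lborel (cbox u v)" for u v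
    proof -
      have "cbox u v = {} \<longleftrightarrow> \<not> (u$1 \<le> v$1 \<and> u$2 \<le> v$2)"
        by (metis (mono_tags) exhaust_2 interval_eq_empty_cart(2) linorder_not_less)
      then show ?thesis
        unfolding img content_Pair by (auto simp: content_cbox_if_cart UNIV_2)
    qed
    show "isCont (\<lambda>x :: real^2. (x$1, x$2)) x" for x
      by (intro continuous_intros)
    show "\<exists>w z. (\<lambda>x :: real^2. (x$1, x$2)) ` cbox u v = cbox w z" for u v
      unfolding img by blast
    show "\<exists>w z. (\<lambda>x :: real\<times>real. vector [fst x, snd x] :: real^2) ` cbox u v = cbox w z" for u v
      unfolding img' by blast
  qed (use assms in \<open>auto simp: vec_eq_iff forall_2\<close>)
  then show ?thesis by (simp add: img')
qed

lemma measure_cball_plane: "0 \<le> T \<Longrightarrow> measure lebesgue (cball (0::real^2) T) = pi * T^2"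
  by (simp add: content_cball unit_ball_vol_2)

text \<open>
  \<open>w \<mapsto> w + \<kappa> cnj w\<close> is a real linear bijection of the plane with determinant
  \<open>1 - |\<kappa>|\<^sup>2\<close>; it turns a suitable ellipse into a disc.
\<close>

lemma inj_real_linear_twist:
  assumes "cmod \<kappa> < 1" "w + \<kappa> * cnj w = v + \<kappa> * cnj v"
  shows "w = v"
proof (rule ccontr)
  assume "w \<noteq> v"
  have "w - v = - \<kappa> * cnj (w - v)" using assms(2) by (simp add: algebra_simps)
  then have "cmod (w - v) = cmod \<kappa> * cmod (w - v)" by (metis complex_mod_cnj norm_minus_cancel norm_mult)
  then show False using \<open>w \<noteq> v\<close> assms(1) by simp
qed

text \<open>
  If \<open>\<Phi>\<close> is injective on a rectangle, so is its twist \<open>\<Phi> + \<kappa> cnj \<Phi>\<close>, whose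
  Jacobian is \<open>(1 - |\<kappa>|\<^sup>2) |\<Phi>'|\<^sup>2\<close>. The image of the twist has at most the area of
  any disc containing it. The function \<open>L\<close> stands for a known lower bound of the inner integral in
  Fubini's theorem. Twisting first means that only the area of a disc is needed later, never that of
  an ellipse.
\<close>

lemma area_le_disc:
  fixes \<Phi> :: "complex \<Rightarrow> complex" and \<kappa> :: complex
  assumes hol: "\<Phi> holomorphic_on U" and U: "open U"
    and rect: "\<And>x y. a \<le> x \<Longrightarrow> x \<le> b \<Longrightarrow> 0 \<le> y \<Longrightarrow> y \<le> d \<Longrightarrow> Complex x y \<in> U"
    and inj: "inj_on \<Phi> {s. a < Re s \<and> Re s < b \<and> 0 < Im s \<and> Im s < d}"
    and \<kappa>: "cmod \<kappa> < 1"
    and bnd: "\<And>s. a < Re s \<Longrightarrow> Re s < b \<Longrightarrow> cmod (\<Phi> s + \<kappa> * cnj (\<Phi> s)) \<le> T"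
    and T: "0 \<le> T"
    and low: "\<And>x. a \<le> x \<Longrightarrow> x \<le> b \<Longrightarrow>
                 L x \<le> integral {0..d} (\<lambda>y. (cmod (deriv \<Phi> (Complex x y)))^2)"
    and L: "(L has_integral M) {a..b}"
  shows "(1 - (cmod \<kappa>)^2) * M \<le> pi * T^2"
proof -
  define J where "J = (\<lambda>(x, y). (cmod (deriv \<Phi> (Complex x y)))^2)"
  define toC where "toC = (\<lambda>v :: real^2. Complex (v$1) (v$2))"
  define ofC where "ofC = (\<lambda>z. vector [Re z, Im z] :: real^2)"
  define I where "I = integral (cbox (a, 0) (b, d)) J"
  define S where "S = (box (vector [a, 0]) (vector [b, d]) :: (real^2) set)"
  define f where "f = (\<lambda>v. ofC (\<Phi> (toC v) + \<kappa> * cnj (\<Phi> (toC v))))"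
  define f' where "f' = (\<lambda>v h. ofC (deriv \<Phi> (toC v) * toC h + \<kappa> * cnj (deriv \<Phi> (toC v) * toC h)))"
  have lin_toC: "bounded_linear toC"
    unfolding toC_def by (intro bounded_linearI' ) (auto simp: complex_eq_iff)
  have lin_ofC: "bounded_linear ofC"
    unfolding ofC_def by (intro bounded_linearI' ) (auto simp: vec_eq_iff forall_2)
  have norm_ofC: "norm (ofC z) = cmod z" for z
    by (simp add: ofC_def norm_vec_def L2_set_def UNIV_2 cmod_def)
  have inS: "v \<in> S \<longleftrightarrow> a < Re (toC v) \<and> Re (toC v) < b \<and> 0 < Im (toC v) \<and> Im (toC v) < d" for v
    by (auto simp: S_def toC_def mem_box_cart forall_2)
  have toC_U: "toC v \<in> U" if "v \<in> S" for v
    using that rect[of "v$1" "v$2"] by (auto simp: inS toC_def)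
  have cont: "continuous_on (cbox (a, 0) (b, d)) J"
  proof -
    have c1: "continuous_on U (deriv \<Phi>)"
      using hol U holomorphic_deriv holomorphic_on_imp_continuous_on by blast
    have c2: "(\<lambda>p. Complex (fst p) (snd p)) ` cbox (a, 0) (b, d) \<subseteq> U"
    proof (rule image_subsetI)
      fix p assume "p \<in> cbox (a, 0) (b, d)"
      then show "Complex (fst p) (snd p) \<in> U"
        by (intro rect) (auto simp: cbox_Pair_eq mem_Times_iff)
    qed
    have c3: "continuous_on (cbox (a, 0) (b, d)) (\<lambda>p. Complex (fst p) (snd p))"
      by (intro continuous_intros)
    have "continuous_on (cbox (a, 0) (b, d)) (\<lambda>p. deriv \<Phi> (Complex (fst p) (snd p)))"
      by (rule continuous_on_compose2[OF c1 c3 c2])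
    then show ?thesis
      unfolding J_def case_prod_unfold by (intro continuous_intros)
  qed
  have "(J has_integral I) (cbox (a, 0) (b, d))"
    unfolding I_def using cont integrable_continuous by blast
  then have "((\<lambda>v. J (v$1, v$2)) has_integral I) (cbox (vector [a, 0]) (vector [b, d] :: real^2))"
    by (rule has_integral_pair_imp_plane)
  then have "((\<lambda>v. J (v$1, v$2)) has_integral I) S"
    unfolding S_def using has_integral_open_interval by blast
  then have int: "((\<lambda>v. (1 - (cmod \<kappa>)^2) * J (v$1, v$2)) has_integral (1 - (cmod \<kappa>)^2) * I) S"
    by (rule has_integral_mult_right)
  have k: "(cmod \<kappa>)^2 < 1" using \<kappa> by (simp add: power_less_one_iff)
  have det: "\<bar>det (matrix (f' v))\<bar> = (1 - (cmod \<kappa>)^2) * J (v$1, v$2)" for v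
  proof -
    have "det (matrix (f' v)) = (1 - (cmod \<kappa>)^2) * (cmod (deriv \<Phi> (toC v)))^2"
      unfolding cmod_power2
      by (simp add: f'_def det_2 matrix_def ofC_def toC_def axis_def)
         (simp add: algebra_simps power2_eq_square)
    then show ?thesis using k by (simp add: J_def toC_def)
  qed
  have der: "(f has_derivative f' v) (at v within S)" if "v \<in> S" for v
  proof -
    have "(\<Phi> has_derivative (\<lambda>h. deriv \<Phi> (toC v) * h)) (at (toC v))"
      using hol U toC_U[OF that] holomorphic_derivI has_field_derivative_imp_has_derivative by blast
    moreover have "(toC has_derivative toC) (at v)"
      using lin_toC by (rule bounded_linear_imp_has_derivative)
    ultimately have *: "((\<lambda>v. \<Phi> (toC v)) has_derivative (\<lambda>h. deriv \<Phi> (toC v) * toC h)) (at v)"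
      using has_derivative_compose by fastforce
    have "((\<lambda>v. \<Phi> (toC v) + \<kappa> * cnj (\<Phi> (toC v))) has_derivative
           (\<lambda>h. deriv \<Phi> (toC v) * toC h + \<kappa> * cnj (deriv \<Phi> (toC v) * toC h))) (at v)"
      by (intro derivative_intros * bounded_linear.has_derivative[OF bounded_linear_cnj])
    then have "(f has_derivative f' v) (at v)"
      unfolding f_def f'_def by (rule bounded_linear.has_derivative[OF lin_ofC])
    then show ?thesis by (rule has_derivative_at_withinI)
  qed
  have injf: "inj_on f S"
  proof (rule inj_onI)
    fix u v assume uv: "u \<in> S" "v \<in> S" "f u = f v"
    then have "\<Phi> (toC u) + \<kappa> * cnj (\<Phi> (toC u)) = \<Phi> (toC v) + \<kappa> * cnj (\<Phi> (toC v))"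
      by (auto simp: f_def ofC_def vec_eq_iff forall_2 complex_eq_iff)
    then have "\<Phi> (toC u) = \<Phi> (toC v)" by (rule inj_real_linear_twist[OF \<kappa>])
    then have "toC u = toC v" using inj_onD[OF inj] uv inS by blast
    then show "u = v" by (auto simp: toC_def vec_eq_iff forall_2)
  qed
  have "S \<in> sets lebesgue" by (simp add: S_def)
  from has_measure_differentiable_image[OF this der injf] int
  have meas: "f ` S \<in> lmeasurable" "measure lebesgue (f ` S) = (1 - (cmod \<kappa>)^2) * I"
    by (auto simp: det)
  have "f ` S \<subseteq> cball 0 T"
    using bnd inS by (auto simp: f_def norm_ofC)
  then have "measure lebesgue (f ` S) \<le> measure lebesgue (cball (0::real^2) T)"
    by (intro measure_mono_fmeasurable) (use meas in auto)
  also have "\<dots> = pi * T^2" using T by (rule measure_cball_plane)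
  finally have "(1 - (cmod \<kappa>)^2) * I \<le> pi * T^2" using meas by simp
  moreover have "M \<le> I"
  proof -
    have "(\<lambda>x. integral {0..d} (\<lambda>y. J (x, y))) integrable_on {a..b}"
      using integral_integrable_2dim[OF cont] by simp
    then have "M \<le> integral {a..b} (\<lambda>x. integral {0..d} (\<lambda>y. J (x, y)))"
      using has_integral_le[OF L integrable_integral] low by (simp add: J_def)
    also have "\<dots> = I"
      unfolding I_def using integral_prod_continuous[OF cont] by simp
    finally show ?thesis .
  qed
  then have "(1 - (cmod \<kappa>)^2) * M \<le> (1 - (cmod \<kappa>)^2) * I"
    using k by (intro mult_left_mono) auto
  ultimately show ?thesis by simp
qed

section \<open>Orthogonality on circles\<close>

lemma holomorphic_disc_split:
  fixes H :: "complex \<Rightarrow> complex"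
  assumes H: "H holomorphic_on ball 0 1"
  obtains H1 :: "complex \<Rightarrow> complex" where "H1 holomorphic_on ball 0 1"
    "\<And>z. cmod z < 1 \<Longrightarrow> H z = H 0 + z * H1 z" "deriv H 0 = H1 0"
proof -
  have "(\<lambda>z. H z - H 0) holomorphic_on ball 0 1" using H by (intro holomorphic_intros)
  then obtain H1 where H1: "H1 holomorphic_on ball 0 1" "\<And>z. cmod z < 1 \<Longrightarrow> H z - H 0 = z * H1 z"
    and d: "deriv (\<lambda>z. H z - H 0) 0 = H1 0"
    using Schwarz3[of "\<lambda>z. H z - H 0" 1] by auto
  have "H field_differentiable at 0"
    using H holomorphic_on_imp_differentiable_at by force
  then have "deriv H 0 = H1 0" using d by (simp add: deriv_diff)
  moreover have "H z = H 0 + z * H1 z" if "cmod z < 1" for z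
    using H1(2)[OF that] by (simp add: algebra_simps)
  ultimately show ?thesis using that H1(1) by blast
qed

text \<open>
  The mean value property on the circle of radius \<open>exp (- 2 * x)\<close>, traversed twice, in the
  logarithmic coordinate \<open>s = Complex x y\<close>. Writing \<open>H z = H 0 + z H1 z\<close> and taking a primitive
  of \<open>H1\<close>, the non-constant part is the derivative of a periodic function of \<open>y\<close>.
\<close>

lemma integral_around_circle:
  fixes H :: "complex \<Rightarrow> complex"
  assumes H: "H holomorphic_on ball 0 1" and x: "0 < x"
  shows "((\<lambda>y. H (exp (- 2 * Complex x y))) has_integral 2 * pi * H 0) {0..2 * pi}"
proof -
  define u where "u = (\<lambda>y. exp (- 2 * Complex x y))"
  have u1: "u y \<in> ball 0 1" for y using x by (simp add: u_def)
  have du: "(u has_vector_derivative u y * (- 2 * \<i>)) (at y within S)" for y S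
  proof -
    have "u = (\<lambda>y. exp (- 2 * (of_real x + \<i> * of_real y)))"
      by (simp add: u_def fun_eq_iff Complex_eq)
    moreover have "((\<lambda>y. exp (- 2 * (of_real x + \<i> * of_real y))) has_vector_derivative
         exp (- 2 * (of_real x + \<i> * of_real y)) * (- 2 * \<i>)) (at y within S)"
      by (rule derivative_eq_intros has_vector_derivative_real_field | simp)+
    ultimately show ?thesis by simp
  qed
  obtain H1 where H1: "H1 holomorphic_on ball 0 1" "\<And>z. cmod z < 1 \<Longrightarrow> H z = H 0 + z * H1 z"
    by (rule holomorphic_disc_split[OF H]) (rule that)
  obtain K where K: "\<And>z. z \<in> ball 0 1 \<Longrightarrow> (K has_field_derivative H1 z) (at z within ball 0 1)"
    using holomorphic_convex_primitive'[OF convex_ball open_ball H1(1)] by blast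
  define F where "F = (\<lambda>y. - K (u y) / (2 * \<i>))"
  have "((\<lambda>y. u y * H1 (u y)) has_integral (F (2 * pi) - F 0)) {0..2 * pi}"
  proof (rule fundamental_theorem_of_calculus)
    fix y assume "y \<in> {0..2*pi}"
    have "(K has_field_derivative H1 (u y)) (at (u y))"
      using K[OF u1[of y]] by (simp only: at_within_open[OF u1 open_ball])
    then have "((K \<circ> u) has_vector_derivative (u y * (- 2 * \<i>)) * H1 (u y)) (at y within {0..2 * pi})"
      by (rule field_vector_diff_chain_within[OF du has_field_derivative_at_within])
    then have "((\<lambda>y. (- 1 / (2*\<i>)) * (K \<circ> u) y) has_vector_derivative
         (- 1 / (2*\<i>)) * ((u y * (- 2 * \<i>)) * H1 (u y))) (at y within {0..2 * pi})"
      by (rule has_vector_derivative_mult_right)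
    then show "(F has_vector_derivative u y * H1 (u y)) (at y within {0..2 * pi})"
      by (simp add: F_def o_def field_simps)
  qed simp
  moreover have "u (2 * pi) = u 0"
    unfolding u_def by (simp add: exp_eq Complex_eq) (rule exI[of _ "-2"], simp)
  ultimately have "((\<lambda>y. u y * H1 (u y)) has_integral 0) {0..2 * pi}"
    by (simp add: F_def)
  moreover have "((\<lambda>y. H 0) has_integral 2 * pi * H 0) {0..2 * pi}"
    using has_integral_const_real[of "H 0" 0 "2*pi"] by (simp add: scaleR_conv_of_real)
  ultimately have "((\<lambda>y. u y * H1 (u y) + H 0) has_integral 0 + 2 * pi * H 0) {0..2 * pi}"
    by (rule has_integral_add)
  moreover have "u y * H1 (u y) + H 0 = H (u y)" for y
    using H1(2)[of "u y"] u1[of y] by (simp add: algebra_simps)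
  ultimately show ?thesis by (simp add: u_def)
qed

text \<open>
  With \<open>H z = H 0 + z H1 z\<close>, multiplying by \<open>exp (2 s)\<close>, the inverse of the
  argument of \<open>H\<close>, leaves a purely oscillating term and the mean of \<open>H1\<close>, whose value at
  \<open>0\<close> is the derivative of \<open>H\<close>.
\<close>

lemma integral_around_circle_deriv:
  fixes H :: "complex \<Rightarrow> complex"
  assumes H: "H holomorphic_on ball 0 1" and x: "0 < x"
  shows "((\<lambda>y. exp (2 * Complex x y) * H (exp (- 2 * Complex x y))) has_integral 2 * pi * deriv H 0) {0..2 * pi}"
proof -
  define v where "v = (\<lambda>y. exp (2 * Complex x y))"
  obtain H1 where H1: "H1 holomorphic_on ball 0 1" "\<And>z. cmod z < 1 \<Longrightarrow> H z = H 0 + z * H1 z"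
    and d: "deriv H 0 = H1 0"
    by (rule holomorphic_disc_split[OF H]) (rule that)
  have "((\<lambda>y. v y) has_integral (v (2 * pi) / (2*\<i>) - v 0 / (2*\<i>))) {0..2 * pi}"
  proof (rule fundamental_theorem_of_calculus)
    fix y :: real
    have "v = (\<lambda>y. exp (2 * (of_real x + \<i> * of_real y)))"
      by (simp add: v_def fun_eq_iff Complex_eq)
    moreover have "((\<lambda>y. exp (2 * (of_real x + \<i> * of_real y)) / (2*\<i>)) has_vector_derivative
         exp (2 * (of_real x + \<i> * of_real y))) (at y within {0..2 * pi})"
      by (rule derivative_eq_intros has_vector_derivative_real_field | simp)+
    ultimately show "((\<lambda>y. v y / (2*\<i>)) has_vector_derivative v y) (at y within {0..2 * pi})" by simp
  qed simp
  moreover have "v (2 * pi) = v 0"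
    unfolding v_def by (simp add: exp_eq Complex_eq)
  ultimately have "((\<lambda>y. v y) has_integral 0) {0..2 * pi}" by simp
  then have "((\<lambda>y. H 0 * v y) has_integral H 0 * 0) {0..2 * pi}"
    by (rule has_integral_mult_right)
  from has_integral_add[OF this integral_around_circle[OF H1(1) x]]
  have "((\<lambda>y. H 0 * v y + H1 (exp (- 2 * Complex x y))) has_integral 2 * pi * H1 0) {0..2 * pi}"
    by simp
  moreover have "H 0 * v y + H1 (exp (- 2 * Complex x y)) = v y * H (exp (- 2 * Complex x y))" for y
  proof -
    have "cmod (exp (- 2 * Complex x y)) < 1" using x by simp
    from H1(2)[OF this] have "H (exp (- 2 * Complex x y)) = H 0 + exp (- 2 * Complex x y) * H1 (exp (- 2 * Complex x y))" .
    then have "v y * H (exp (- 2 * Complex x y)) = H 0 * v y + (v y * exp (- 2 * Complex x y)) * H1 (exp (- 2 * Complex x y))"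
      by (simp add: algebra_simps)
    moreover have "v y * exp (- 2 * Complex x y) = 1" by (simp add: v_def flip: exp_add)
    ultimately show ?thesis by simp
  qed
  ultimately show ?thesis by (simp add: v_def d)
qed

text \<open>
  The Bessel inequality for the first two Taylor coefficients of \<open>H\<close>. Let \<open>P\<close> be the
  part of \<open>A = exp s * H (exp (- 2 s))\<close> coming from these two coefficients. Both \<open>cnj P * A\<close>
  and \<open>cnj P * P\<close> have the same integral over the circle, and pointwise
  \<open>|A|\<^sup>2 \<ge> 2 Re (cnj P * A) - |P|\<^sup>2\<close>; so no convergence of series is involved.
\<close>

lemma circle_mean_square_ge:
  fixes H :: "complex \<Rightarrow> complex"
  assumes H: "H holomorphic_on ball 0 1" and H0: "H 0 = 1" and x: "0 < x"
  shows "2 * pi * (exp (2 * x) + (cmod (deriv H 0))^2 * exp (- 2 * x))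
       \<le> integral {0..2*pi} (\<lambda>y. (cmod (exp (Complex x y) * H (exp (- 2 * Complex x y))))^2)"
proof -
  define c where "c = deriv H 0"
  define N where "N = exp (2 * x) + (cmod c)^2 * exp (- 2 * x)"
  define P where "P = (\<lambda>s. exp s * (1 + c * exp (- 2 * s)))"
  have pair: "((\<lambda>y. cnj (P (Complex x y)) * (exp (Complex x y) * G (exp (- 2 * Complex x y))))
       has_integral of_real (2 * pi * N)) {0..2*pi}"
    if G: "G holomorphic_on ball 0 1" and G0: "G 0 = 1" and G1: "deriv G 0 = c" for G :: "complex \<Rightarrow> complex"
  proof -
    have *: "cnj (P s) = exp (2 * of_real (Re s)) * exp (- s) + cnj c * exp (- 2 * of_real (Re s)) * exp s" for s
    proof -
      have s: "cnj s = 2 * of_real (Re s) + (- s)" by (simp add: complex_eq_iff)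
      then have s': "- cnj s = - 2 * of_real (Re s) + s" by simp
      have "cnj (exp s) = exp (2 * of_real (Re s)) * exp (- s)"
        by (simp only: exp_cnj s exp_add)
      moreover have "cnj (exp (-s)) = exp (- 2 * of_real (Re s)) * exp s"
        by (simp only: exp_cnj complex_cnj_minus s' exp_add)
      moreover have "P s = exp s + c * exp (-s)"
        by (simp add: P_def algebra_simps flip: exp_add)
      ultimately show ?thesis by simp
    qed
    have "cnj (P s) * (exp s * G (exp (- 2 * s))) =
       exp (2 * of_real (Re s)) * G (exp (- 2 * s)) + cnj c * exp (- 2 * of_real (Re s)) * (exp (2 * s) * G (exp (- 2 * s)))" for s
    proof -
      have e: "exp (- s) * exp s = 1" "exp s * exp s = exp (2 * s)" by (simp_all flip: exp_add)
      have "(A * em + B * ep) * (ep * g) = A * ((em * ep) * g) + B * ((ep * ep) * g)" for A B em ep g :: complex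
        by (simp add: algebra_simps)
      then show ?thesis unfolding * e by (simp only: e mult_1)
    qed
    from this[of "Complex x _"] have eq: "cnj (P (Complex x y)) * (exp (Complex x y) * G (exp (- 2 * Complex x y))) =
       exp (2 * of_real x) * G (exp (- 2 * Complex x y)) + cnj c * exp (- 2 * of_real x) * (exp (2 * Complex x y) * G (exp (- 2 * Complex x y)))" for y
      by (simp only: complex.sel)
    have "((\<lambda>y. exp (2 * of_real x) * G (exp (- 2 * Complex x y)) + cnj c * exp (- 2 * of_real x) * (exp (2 * Complex x y) * G (exp (- 2 * Complex x y))))
      has_integral exp (2 * of_real x) * (2 * pi * G 0) + cnj c * exp (- 2 * of_real x) * (2 * pi * deriv G 0)) {0..2*pi}"
      using integral_around_circle[OF G x] integral_around_circle_deriv[OF G x]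
      by (intro has_integral_add has_integral_mult_right) (simp_all add: algebra_simps)
    moreover have "exp (2 * of_real x) * (2 * pi * G 0) + cnj c * exp (- 2 * of_real x) * (2 * pi * deriv G 0) = of_real (2 * pi * N)"
    proof -
      have "exp (2 * of_real x) = complex_of_real (exp (2 * x))" "exp (- 2 * of_real x) = complex_of_real (exp (- 2 * x))"
        by (simp_all add: exp_of_real[symmetric])
      then show ?thesis
        unfolding G0 G1 N_def using complex_norm_square[of c] by (simp add: algebra_simps)
    qed
    ultimately show ?thesis unfolding eq by simp
  qed
  define A where "A = (\<lambda>y. exp (Complex x y) * H (exp (- 2 * Complex x y)))"
  have "((\<lambda>y. cnj (P (Complex x y)) * A y) has_integral of_real (2 * pi * N)) {0..2*pi}"
    unfolding A_def by (rule pair) (use H H0 c_def in auto)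
  from has_integral_Re[OF this]
  have 1: "((\<lambda>y. Re (cnj (P (Complex x y)) * A y)) has_integral 2 * pi * N) {0..2*pi}"
    by (simp only: Re_complex_of_real)
  have "deriv (\<lambda>u. 1 + c * u) 0 = c"
    by (rule DERIV_imp_deriv) (auto intro!: derivative_eq_intros)
  then have "((\<lambda>y. cnj (P (Complex x y)) * P (Complex x y)) has_integral of_real (2 * pi * N)) {0..2*pi}"
    unfolding P_def by (intro pair[unfolded P_def, of "\<lambda>u. 1 + c * u"] holomorphic_intros) simp_all
  from has_integral_Re[OF this]
  have 2: "((\<lambda>y. Re (cnj (P (Complex x y)) * P (Complex x y))) has_integral 2 * pi * N) {0..2*pi}"
    by (simp only: Re_complex_of_real)
  from has_integral_diff[OF has_integral_mult_right[OF 1, of 2] 2]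
  have 3: "((\<lambda>y. 2 * Re (cnj (P (Complex x y)) * A y) - Re (cnj (P (Complex x y)) * P (Complex x y)))
     has_integral 2 * pi * N) {0..2*pi}" by (simp only: mult_2 add_diff_cancel_right')
  have "continuous_on {0..2*pi} A"
  proof -
    have "continuous_on {0..2*pi} (\<lambda>y. H (exp (- 2 * Complex x y)))"
      by (rule continuous_on_compose2[OF holomorphic_on_imp_continuous_on[OF H]])
         (use x in \<open>auto intro!: continuous_intros\<close>)
    then show ?thesis unfolding A_def by (intro continuous_intros)
  qed
  then have "(\<lambda>y. (cmod (A y))^2) integrable_on {0..2*pi}"
    by (intro integrable_continuous_real continuous_intros)
  moreover have "2 * Re (cnj p * a) - Re (cnj p * p) \<le> (cmod a)^2" for p a
  proof -
    have "0 \<le> (cmod (a - p))^2" by simp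
    then show ?thesis unfolding cmod_power2 by (simp add: power2_eq_square algebra_simps)
  qed
  ultimately have "2 * pi * N \<le> integral {0..2*pi} (\<lambda>y. (cmod (A y))^2)"
    by (intro has_integral_le[OF 3 integrable_integral]) auto
  then show ?thesis by (simp add: A_def N_def c_def)
qed

section \<open>The area theorem and the second coefficient\<close>

text \<open>
  The estimate showing that the twisted image of the annulus \<open>1 < |\<zeta>| < S\<close> stays in a disc of
  radius \<open>S + O(1 / S\<^sup>2)\<close>; here \<open>t = |\<zeta>|\<close>. Near the outer circle the error term
  \<open>C / t\<^sup>3\<close> is already \<open>O(1 / S\<^sup>2)\<close>, and further inside it is absorbed by the
  slack \<open>S - t\<close>.
\<close>

lemma tail_bound_real:
  fixes t S C D :: real
  assumes t: "1 < t" "t \<le> S" and C: "0 \<le> C" "8 * C \<le> S" and D: "0 \<le> D" "4 * D \<le> S"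
  shows "t + D / t * (1 - t^2 / S^2) + 2 * C / t^3 + D^2 / S^2 / t \<le> S + (16 * C + D^2) / S^2"
proof -
  have S: "1 < S" using t by simp
  have "D / t * (1 - t^2 / S^2) = (S - t) * (D * (S + t) / (t * S^2))"
    using t S by (simp add: field_simps power2_eq_square)
  also have "\<dots> \<le> (S - t) * (1/2)"
  proof (rule mult_left_mono)
    have "D * (S + t) \<le> (S / 4) * (2 * S)" using D t by (intro mult_mono) auto
    also have "\<dots> \<le> 1/2 * (t * S^2)" using t S by (simp add: power2_eq_square)
    finally show "D * (S + t) / (t * S^2) \<le> 1/2" using t S by (simp add: divide_le_eq)
  qed (use t in auto)
  finally have 1: "D / t * (1 - t^2 / S^2) \<le> (S - t) / 2" by simp
  have 2: "D^2 / S^2 / t \<le> D^2 / S^2" using t by (simp add: divide_le_eq mult_le_cancel_left1)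
  have 3: "2 * C / t^3 \<le> (S - t) / 2 + 16 * C / S^2"
  proof (cases "S / 2 \<le> t")
    case True
    have "S^2 \<le> S^3" using S by (simp add: power_increasing)
    also have "\<dots> = 8 * (S/2)^3" by (simp add: power3_eq_cube)
    also have "\<dots> \<le> 8 * t^3" using True S by (intro mult_left_mono power_mono) auto
    finally have "2 * C * S^2 \<le> 16 * C * t^3" using C mult_left_mono[of "S^2" "8 * t^3" "2*C"] by (simp add: algebra_simps)
    then have "2 * C / t^3 \<le> 16 * C / S^2" using t S by (simp add: field_simps)
    moreover have "0 \<le> (S - t) / 2" using t by simp
    ultimately show ?thesis by linarith
  next
    case False
    have "2 * C / t^3 \<le> 2 * C" using t C by (simp add: divide_le_eq mult_le_cancel_left1 one_le_power)
    also have "\<dots> \<le> (S - t) / 2" using False C by simp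
    also have "\<dots> \<le> (S - t) / 2 + 16 * C / S^2" using C by simp
    finally show ?thesis .
  qed
  have "(16 * C + D^2) / S^2 = 16 * C / S^2 + D^2 / S^2" by (rule add_divide_distrib)
  moreover have "t + p + q + r \<le> S + (v + w)"
    if "p \<le> (S - t) / 2" "q \<le> (S - t) / 2 + v" "r \<le> w" for p q r v w :: real
    using that by argo
  ultimately show ?thesis using 1 2 3 by simp
qed

text \<open>
  What the comparison of areas says as the outer radius \<open>S\<close> tends to infinity. The terms of order
  \<open>S\<^sup>2\<close> cancel, and the error \<open>B / S\<^sup>2\<close> of the radius contributes only
  \<open>O(1 / S)\<close> to the area, so the constant terms can be compared.
\<close>

lemma limit_inequality:
  fixes E B D :: real
  assumes ev: "eventually (\<lambda>S. (1 - D^2 / S^4) * (S^2 - E - D^2 / S^2) \<le> (S + B / S^2)^2) at_top"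
  shows "0 \<le> E"
proof -
  define R where "R = (\<lambda>S::real. 2 * B * (inverse S) + B^2 * (inverse S)^4 + 2 * D^2 * (inverse S)^2
       - D^2 * E * (inverse S)^4 - D^4 * (inverse S)^6)"
  have "(R \<longlongrightarrow> 2 * B * 0 + B^2 * 0^4 + 2 * D^2 * 0^2 - D^2 * E * 0^4 - D^4 * 0^6) at_top"
    unfolding R_def by (intro tendsto_intros tendsto_inverse_0_at_top filterlim_ident)
  then have "(R \<longlongrightarrow> 0) at_top" by simp
  moreover have "eventually (\<lambda>S. - E \<le> R S) at_top"
    using ev eventually_gt_at_top[of 0]
  proof eventually_elim
    case (elim S)
    have "(S + B / S^2)^2 - (1 - D^2 / S^4) * (S^2 - E - D^2 / S^2) = E + R S"
      unfolding R_def using elim by (simp add: field_simps power2_eq_square eval_nat_numeral)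
    then show ?case using elim by simp
  qed
  ultimately have "- E \<le> 0" by (rule tendsto_lowerbound) simp
  then show ?thesis by simp
qed

text \<open>
  Gronwall's area theorem, restricted to the first coefficient of the odd function
  \<open>G \<zeta> = \<zeta> q (1 / \<zeta>\<^sup>2) = \<zeta> + c / \<zeta> + O(|\<zeta>|\<^sup>-\<^sup>3)\<close>. For injective \<open>G\<close>, the area of the image
  of the annulus \<open>a < |\<zeta>| < S\<close> is the integral of \<open>|G'|\<^sup>2\<close>, hence at least
  \<open>\<pi> (S\<^sup>2 - a\<^sup>2 + |c|\<^sup>2 (1 / a\<^sup>2 - 1 / S\<^sup>2))\<close>. This image lies within the
  ellipse that \<open>\<zeta> + c / \<zeta>\<close> makes of the outer circle, up to \<open>O(1 / S\<^sup>2)\<close>, and that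
  ellipse has area at most \<open>\<pi> S\<^sup>2\<close>. Letting \<open>S\<close> tend to infinity and then
  \<open>a\<close> to \<open>1\<close> gives \<open>|c| \<le> 1\<close>.
  Polar coordinates are replaced by \<open>\<zeta> = exp s\<close>, which makes the annulus a rectangle.
\<close>

theorem area_theorem_first_coefficient:
  fixes q :: "complex \<Rightarrow> complex"
  assumes q: "q holomorphic_on ball 0 1" and q0: "q 0 = 1"
    and inj: "inj_on (\<lambda>\<zeta>. \<zeta> * q (1 / \<zeta>^2)) {\<zeta>. 1 < cmod \<zeta>}"
  shows "cmod (deriv q 0) \<le> 1"
proof -
  define c where "c = deriv q 0"
  define D where "D = cmod c"
  have D0: "0 \<le> D" by (simp add: D_def)
  obtain q1 where q1: "q1 holomorphic_on ball 0 1" "\<And>z. cmod z < 1 \<Longrightarrow> q z = q 0 + z * q1 z" "deriv q 0 = q1 0"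
    by (rule holomorphic_disc_split[OF q]) (rule that)
  obtain q2 where q2: "q2 holomorphic_on ball 0 1" "\<And>z. cmod z < 1 \<Longrightarrow> q1 z = q1 0 + z * q2 z"
    by (rule holomorphic_disc_split[OF q1(1)]) (rule that)
  have q_expand: "q z = 1 + c * z + z^2 * q2 z" if "cmod z < 1" for z
    using q1(2)[OF that] q2(2)[OF that] q1(3) q0
    by (simp add: c_def algebra_simps power2_eq_square)
  define \<Phi> where "\<Phi> = (\<lambda>s. exp s * q (exp (- 2 * s)))"
  define U where "U = {s. 0 < Re s}"
  \<comment> \<open>The derivative of \<open>\<Phi>\<close> is \<open>exp s * H (exp (- 2 s))\<close>.\<close>
  define H where "H = (\<lambda>u. q u - 2 * u * deriv q u)"
  have U: "open U" unfolding U_def by (rule open_halfspace_Re_gt)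
  have in1: "exp (- 2 * s) \<in> ball 0 1" if "s \<in> U" for s using that by (simp add: U_def)
  have dq: "(q has_field_derivative deriv q u) (at u)" if "u \<in> ball 0 1" for u
    using q that holomorphic_derivI open_ball by blast
  have d\<Phi>: "(\<Phi> has_field_derivative exp s * H (exp (- 2 * s))) (at s)" if "s \<in> U" for s
  proof -
    have "((\<lambda>s. q (exp (- 2 * s))) has_field_derivative deriv q (exp (- 2 * s)) * (exp (- 2 * s) * - 2)) (at s)"
      by (rule DERIV_chain2[where f = q and g = "\<lambda>s. exp (- 2 * s)", OF dq[OF in1[OF that]]]) (auto intro!: derivative_eq_intros)
    from DERIV_mult[OF DERIV_exp this] show ?thesis
      unfolding \<Phi>_def H_def by (simp add: algebra_simps)
  qed
  have \<Phi>_eq: "\<Phi> r = exp r * q (1 / (exp r)^2)" for r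
  proof -
    have "exp (- 2 * r) = 1 / (exp r)^2"
      by (simp add: exp_minus inverse_eq_divide flip: exp_double)
    then show ?thesis by (simp only: \<Phi>_def)
  qed
  have hol: "\<Phi> holomorphic_on U"
    using d\<Phi> U by (auto simp: holomorphic_on_open)
  have deriv\<Phi>: "deriv \<Phi> s = exp s * H (exp (- 2 * s))" if "s \<in> U" for s
    using d\<Phi>[OF that] by (rule DERIV_imp_deriv)
  have Hhol: "H holomorphic_on ball 0 1"
    unfolding H_def by (intro holomorphic_intros q) auto
  have H0: "H 0 = 1" by (simp add: H_def q0)
  have H1: "deriv H 0 = - c"
  proof -
    have "(deriv q has_field_derivative deriv (deriv q) 0) (at 0)"
      using holomorphic_derivI[OF holomorphic_deriv[OF q open_ball] open_ball] by simp
    moreover have "(q has_field_derivative deriv q 0) (at 0)" by (rule dq) simp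
    ultimately have "(H has_field_derivative deriv q 0 - (2 * deriv q 0)) (at 0)"
      unfolding H_def by (auto intro!: derivative_eq_intros)
    then show ?thesis by (simp add: DERIV_imp_deriv c_def)
  qed
  have main: "0 \<le> a^2 - D^2 / a^2" if a: "1 < a" for a :: real
  proof -
    have "compact (q2 ` cball 0 (1 / a^2))"
    proof (intro compact_continuous_image)
      show "continuous_on (cball 0 (1 / a^2)) q2"
      proof (intro holomorphic_on_imp_continuous_on holomorphic_on_subset[OF q2(1)] cball_subset_ball_iff[THEN iffD2] disjI1)
        show "dist (0::complex) 0 + 1 / a^2 < 1" using a by (simp add: divide_less_eq one_less_power)
      qed
    qed simp
    then obtain C0 where C0: "\<And>z. cmod z \<le> 1 / a^2 \<Longrightarrow> cmod (q2 z) \<le> C0"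
      using compact_imp_bounded by (fastforce simp: bounded_iff)
    define C where "C = max 0 C0"
    have C: "0 \<le> C" "\<And>z. cmod z \<le> 1 / a^2 \<Longrightarrow> cmod (q2 z) \<le> C"
      using C0 by (force simp: C_def)+
    define B where "B = 16 * C + D^2"
    have "eventually (\<lambda>S. (1 - D^2 / S^4) * (S^2 - (a^2 - D^2 / a^2) - D^2 / S^2) \<le> (S + B / S^2)^2) at_top"
      using eventually_gt_at_top[of a] eventually_ge_at_top[of "8 * C"] eventually_ge_at_top[of "4 * D"]
    proof eventually_elim
      case (elim S)
      have S1: "1 < S" using elim a by simp
      \<comment> \<open>On the circle of radius \<open>S\<close> this \<open>\<kappa>\<close> cancels the term \<open>c / \<zeta>\<close>.\<close>
      define \<kappa> where "\<kappa> = - c / of_real (S^2)"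
      have nk: "cmod \<kappa> = D / S^2" by (simp add: \<kappa>_def D_def norm_divide norm_power)
      have "D < S^2"
      proof -
        have "D \<le> S / 4" using elim by simp
        also have "S / 4 < S * 1" using S1 by simp
        also have "\<dots> < S * S" using S1 by (intro mult_strict_left_mono) auto
        finally show ?thesis by (simp add: power2_eq_square)
      qed
      then have k1: "cmod \<kappa> < 1" using nk S1 D0 by (simp add: divide_less_eq)
      define L where "L = (\<lambda>x. 2 * pi * (exp (2 * x) + D^2 * exp (- 2 * x)))"
      have "(1 - (cmod \<kappa>)^2) * (pi * (S^2 - (a^2 - D^2 / a^2) - D^2 / S^2)) \<le> pi * (S + B / S^2)^2"
      proof (rule area_le_disc[OF hol U, where a = "ln a" and b = "ln S" and d = "2 * pi" and L = L])
        show "Complex x y \<in> U" if "ln a \<le> x" for x y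
          using less_le_trans[OF ln_gt_zero[OF a] that] by (simp add: U_def)
        show "inj_on \<Phi> {s. ln a < Re s \<and> Re s < ln S \<and> 0 < Im s \<and> Im s < 2 * pi}"
        proof (rule inj_onI, clarify)
          fix s t assume s: "ln a < Re s" "0 < Im s" "Im s < 2 * pi"
            and t: "ln a < Re t" "0 < Im t" "Im t < 2 * pi" and eq: "\<Phi> s = \<Phi> t"
          have "0 < Re s" "0 < Re t" using less_trans[OF ln_gt_zero[OF a]] s t by blast+
          then have "exp s \<in> {\<zeta>. 1 < cmod \<zeta>}" "exp t \<in> {\<zeta>. 1 < cmod \<zeta>}" by simp_all
          moreover have "exp s * q (1 / (exp s)^2) = exp t * q (1 / (exp t)^2)"
            using eq unfolding \<Phi>_eq .
          ultimately have "exp s = exp t" using inj_onD[OF inj] by blast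
          moreover have "\<bar>Im s - Im t\<bar> < 2 * pi" using s t by linarith
          ultimately show "s = t" by (rule exp_complex_eqI[rotated])
        qed
        show "cmod \<kappa> < 1" by (rule k1)
        show "0 \<le> S + B / S^2" using S1 C D0 by (simp add: B_def)
        show "cmod (\<Phi> s + \<kappa> * cnj (\<Phi> s)) \<le> S + B / S^2" if s: "ln a < Re s" "Re s < ln S" for s
        proof -
          define \<zeta> where "\<zeta> = exp s"
          define t where "t = cmod \<zeta>"
          define u where "u = 1 / \<zeta>^2"
          define \<eta> where "\<eta> = \<zeta> * (u^2 * q2 u)"
          have "exp (ln a) < exp (Re s)" "exp (Re s) < exp (ln S)" using s by simp_all
          then have t: "a < t" "t < S" using a S1 by (simp_all add: t_def \<zeta>_def)
          have z: "\<zeta> \<noteq> 0" by (simp add: \<zeta>_def)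
          have nu: "cmod u = 1 / t^2" by (simp add: u_def t_def norm_divide norm_power)
          have ta: "1 / t^2 \<le> 1 / a^2" using t a by (intro divide_left_mono power_mono) auto
          have "1 / a^2 < 1" using a by (simp add: divide_less_eq one_less_power)
          then have u1: "cmod u < 1" using nu ta by simp
          have "\<Phi> s = \<zeta> * q u"
            by (simp only: \<Phi>_eq \<zeta>_def u_def)
          also have "\<dots> = \<zeta> + c / \<zeta> + \<eta>"
            unfolding q_expand[OF u1] \<eta>_def using z by (simp add: u_def field_simps power2_eq_square)
          finally have \<Phi>s: "\<Phi> s = \<zeta> + c / \<zeta> + \<eta>" .
          have n\<eta>: "cmod \<eta> \<le> C / t^3"
          proof -
            have "cmod \<eta> = t * ((1 / t^2)^2 * cmod (q2 u))"
              by (simp add: \<eta>_def norm_mult norm_power nu t_def)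
            also have "\<dots> \<le> t * ((1 / t^2)^2 * C)"
              using t a C(2)[of u] nu ta by (intro mult_left_mono) auto
            also have "\<dots> = C / t^3" using t a by (simp add: field_simps eval_nat_numeral)
            finally show ?thesis .
          qed
          have czz: "cnj \<zeta> = of_real (t^2) / \<zeta>"
            using z complex_norm_square[of \<zeta>] by (simp add: t_def field_simps)
          have "c / \<zeta> + \<kappa> * cnj \<zeta> = c / \<zeta> * of_real (1 - t^2 / S^2)"
            unfolding czz \<kappa>_def using z S1 by (simp add: field_simps)
          then have "\<Phi> s + \<kappa> * cnj (\<Phi> s) = \<zeta> + c / \<zeta> * of_real (1 - t^2 / S^2) + (\<eta> + \<kappa> * cnj \<eta>) + \<kappa> * cnj (c / \<zeta>)"
            unfolding \<Phi>s by (simp add: algebra_simps)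
          also have "cmod \<dots> \<le> cmod \<zeta> + cmod (c / \<zeta> * of_real (1 - t^2 / S^2)) + (cmod \<eta> + cmod (\<kappa> * cnj \<eta>)) + cmod (\<kappa> * cnj (c / \<zeta>))"
            by (intro norm_triangle_mono order_refl)
          also have "\<dots> \<le> t + D / t * (1 - t^2 / S^2) + 2 * C / t^3 + D^2 / S^2 / t"
          proof (intro add_mono)
            have "t^2 / S^2 \<le> 1" using t a S1 by (simp add: divide_le_eq power_mono)
            then have "cmod (of_real (1 - t^2 / S^2)) = 1 - t^2 / S^2" unfolding norm_of_real by simp
            then show "cmod (c / \<zeta> * of_real (1 - t^2 / S^2)) \<le> D / t * (1 - t^2 / S^2)"
              unfolding norm_mult norm_divide by (simp only: D_def t_def order_refl)
            have "cmod (\<kappa> * cnj \<eta>) \<le> 1 * cmod \<eta>"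
              unfolding norm_mult complex_mod_cnj using k1 by (intro mult_right_mono) auto
            then show "cmod \<eta> + cmod (\<kappa> * cnj \<eta>) \<le> 2 * C / t^3" using n\<eta> by simp
            show "cmod (\<kappa> * cnj (c / \<zeta>)) \<le> D^2 / S^2 / t"
              unfolding norm_mult complex_mod_cnj nk by (simp add: norm_divide D_def t_def power2_eq_square)
          qed (simp add: t_def)
          also have "\<dots> \<le> S + B / S^2"
            unfolding B_def using t a elim C D0 by (intro tail_bound_real) auto
          finally show ?thesis .
        qed
        show "L x \<le> integral {0..2 * pi} (\<lambda>y. (cmod (deriv \<Phi> (Complex x y)))\<^sup>2)" if "ln a \<le> x" for x
        proof -
          have x: "0 < x" using less_le_trans[OF ln_gt_zero[OF a] that] .
          then have "Complex x y \<in> U" for y by (simp add: U_def)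
          then show ?thesis
            using circle_mean_square_ge[OF Hhol H0 x] by (simp add: deriv\<Phi> L_def H1 D_def)
        qed
        \<comment> \<open>A primitive of \<open>L\<close>.\<close>
        define F where "F = (\<lambda>x. pi * (exp (2 * x) - D^2 * exp (- 2 * x)))"
        have "(L has_integral F (ln S) - F (ln a)) {ln a..ln S}"
        proof (rule fundamental_theorem_of_calculus)
          show "(F has_vector_derivative L x) (at x within {ln a..ln S})" for x
            unfolding F_def L_def has_real_derivative_iff_has_vector_derivative[symmetric]
            by (auto intro!: derivative_eq_intros simp: algebra_simps)
        qed (use elim a in simp)
        moreover have "exp (2 * ln r) = r^2" "exp (- 2 * ln r) = 1 / r^2" if "1 < r" for r :: real
          using that by (simp_all add: exp_double exp_minus divide_inverse)
        then have "F (ln S) - F (ln a) = pi * (S^2 - (a^2 - D^2 / a^2) - D^2 / S^2)"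
          unfolding F_def using a S1 by (simp add: algebra_simps)
        ultimately show "(L has_integral pi * (S^2 - (a^2 - D^2 / a^2) - D^2 / S^2)) {ln a..ln S}" by simp
      qed
      then have "pi * ((1 - (cmod \<kappa>)^2) * (S^2 - (a^2 - D^2 / a^2) - D^2 / S^2)) \<le> pi * (S + B / S^2)^2"
        by (simp only: mult_ac)
      then have "(1 - (cmod \<kappa>)^2) * (S^2 - (a^2 - D^2 / a^2) - D^2 / S^2) \<le> (S + B / S^2)^2"
        by (simp only: mult_le_cancel_left_pos[OF pi_gt_zero])
      moreover have "(cmod \<kappa>)^2 = D^2 / S^4" by (simp add: nk power_divide flip: power_mult)
      ultimately show ?case by simp
    qed
    then show ?thesis by (rule limit_inequality)
  qed
  have "D \<le> a^2" if "1 < a" for a :: real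
  proof -
    have "D^2 \<le> (a^2)^2" using main[OF that] that by (simp add: divide_le_eq power2_eq_square field_simps)
    then show ?thesis by (rule power2_le_imp_le) simp
  qed
  then have "D \<le> b" if "1 < b" for b :: real
    using that by (metis less_eq_real_def order_less_trans real_sqrt_gt_1_iff real_sqrt_pow2 zero_less_one)
  then have "D \<le> 1" by (rule dense_ge)
  then show ?thesis by (simp add: D_def c_def)
qed

lemma holomorphic_disc_log:
  assumes "f holomorphic_on ball 0 1" "\<And>z. z \<in> ball 0 1 \<Longrightarrow> f z \<noteq> 0"
  obtains l where "l holomorphic_on ball 0 1" "\<And>z. z \<in> ball 0 1 \<Longrightarrow> f z = exp (l z)"
proof -
  have "simply_connected (ball (0::complex) 1)" by (simp add: convex_imp_simply_connected)
  then show ?thesis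
    using assms that unfolding simply_connected_eq_holomorphic_log[OF open_ball] by blast
qed

text \<open>
  Bieberbach's bound for the second Taylor coefficient. The function
  \<open>\<zeta> q (1 / \<zeta>\<^sup>2)\<close>, with \<open>(q z)\<^sup>2 = z F'(0) / (F z - F 0)\<close>, is the reciprocal of
  the square root transform of \<open>(F - F 0) / F'(0)\<close>, taken at \<open>1 / \<zeta>\<close>: its square determines \<open>F (1 / \<zeta>\<^sup>2)\<close>, hence
  \<open>\<zeta>\<^sup>2\<close>, and then the value itself determines \<open>\<zeta>\<close>. Its first coefficient is
  proportional to \<open>F''(0)\<close>.
\<close>

theorem bieberbach_second_coefficient:
  assumes F: "F holomorphic_on ball 0 1" and inj: "inj_on F (ball 0 1)"
  shows "cmod (deriv (deriv F) 0) \<le> 4 * cmod (deriv F 0)"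
proof -
  obtain F1 where F1: "F1 holomorphic_on ball 0 1" "\<And>z. cmod z < 1 \<Longrightarrow> F z = F 0 + z * F1 z"
    and d0: "deriv F 0 = F1 0"
    by (rule holomorphic_disc_split[OF F]) (rule that)
  have "deriv F 0 \<noteq> 0"
    using holomorphic_injective_imp_regular[OF F open_ball inj] by simp
  then have A: "F1 0 \<noteq> 0" using d0 by simp
  have nz: "F1 z \<noteq> 0" if "z \<in> ball 0 1" for z
  proof (cases "z = 0")
    case False
    then have "F z \<noteq> F 0" using inj_onD[OF inj, of z 0] that by auto
    then show ?thesis using F1(2)[of z] that by auto
  qed (use A in simp)
  have dF1: "(F1 has_field_derivative deriv F1 z) (at z)" if "z \<in> ball 0 1" for z
    using F1(1) that holomorphic_derivI open_ball by blast
  have dF: "deriv F z = F1 z + z * deriv F1 z" if "z \<in> ball 0 1" for z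
  proof (rule DERIV_imp_deriv)
    have "((\<lambda>z. F 0 + z * F1 z) has_field_derivative F1 z + z * deriv F1 z) (at z)"
      using dF1[OF that] by (auto intro!: derivative_eq_intros)
    then show "(F has_field_derivative F1 z + z * deriv F1 z) (at z)"
      by (rule has_field_derivative_transform_within_open[OF _ open_ball that]) (rule F1(2)[symmetric], simp)
  qed
  have ddF: "deriv (deriv F) 0 = 2 * deriv F1 0"
  proof (rule DERIV_imp_deriv)
    have "(deriv F1 has_field_derivative deriv (deriv F1) 0) (at 0)"
      using holomorphic_derivI[OF holomorphic_deriv[OF F1(1) open_ball] open_ball] by simp
    then have "((\<lambda>z. F1 z + z * deriv F1 z) has_field_derivative 2 * deriv F1 0) (at 0)"
      using dF1[of 0] by (auto intro!: derivative_eq_intros)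
    then show "(deriv F has_field_derivative 2 * deriv F1 0) (at 0)"
      by (rule has_field_derivative_transform_within_open[OF _ open_ball, of _ _ _ 0 1]) (simp_all add: dF)
  qed
  obtain l where l: "l holomorphic_on ball 0 1" "\<And>z. z \<in> ball 0 1 \<Longrightarrow> F1 z = exp (l z)"
    using holomorphic_disc_log[OF F1(1) nz] by blast
  define q where "q = (\<lambda>z. exp ((l 0 - l z) / 2))"
  have q: "q holomorphic_on ball 0 1" unfolding q_def by (intro holomorphic_intros l) auto
  have q0: "q 0 = 1" by (simp add: q_def)
  have qnz: "q z \<noteq> 0" for z by (simp add: q_def)
  have qsq: "(q z)^2 = F1 0 / F1 z" if "z \<in> ball 0 1" for z
  proof -
    have "2 * ((l 0 - l z) / 2) = l 0 - l z" by simp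
    then have "(q z)^2 = exp (l 0 - l z)" by (simp only: q_def flip: exp_double)
    then show ?thesis using l(2)[OF that] l(2)[of 0] by (simp add: exp_diff)
  qed
  have dl: "(l has_field_derivative deriv l 0) (at 0)"
    using holomorphic_derivI[OF l(1) open_ball] by simp
  have "deriv F1 0 = F1 0 * deriv l 0"
  proof (rule DERIV_imp_deriv)
    have "((\<lambda>z. exp (l z)) has_field_derivative F1 0 * deriv l 0) (at 0)"
      using dl l(2)[of 0] by (auto intro!: derivative_eq_intros)
    then show "(F1 has_field_derivative F1 0 * deriv l 0) (at 0)"
      by (rule has_field_derivative_transform_within_open[OF _ open_ball, of _ _ _ 0 1]) (simp_all add: l(2))
  qed
  moreover have "deriv q 0 = - deriv l 0 / 2"
    unfolding q_def by (rule DERIV_imp_deriv) (use dl in \<open>auto intro!: derivative_eq_intros\<close>)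
  ultimately have dq: "deriv (deriv F) 0 = - 4 * deriv F 0 * deriv q 0"
    by (simp add: ddF d0)
  have "inj_on (\<lambda>\<zeta>. \<zeta> * q (1 / \<zeta>^2)) {\<zeta>. 1 < cmod \<zeta>}"
  proof (rule inj_onI)
    fix \<zeta> \<xi> :: complex
    assume z: "\<zeta> \<in> {\<zeta>. 1 < cmod \<zeta>}" and x: "\<xi> \<in> {\<zeta>. 1 < cmod \<zeta>}"
      and eq: "\<zeta> * q (1 / \<zeta>^2) = \<xi> * q (1 / \<xi>^2)"
    have inb: "1 / \<zeta>^2 \<in> ball 0 1" if "\<zeta> \<in> {\<zeta>. 1 < cmod \<zeta>}" for \<zeta> :: complex
      using that by (simp add: norm_divide norm_power divide_less_eq one_less_power)
    have sq: "(\<zeta> * q (1 / \<zeta>^2))^2 = F1 0 / (F (1 / \<zeta>^2) - F 0)" if "\<zeta> \<in> {\<zeta>. 1 < cmod \<zeta>}" for \<zeta>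
    proof -
      have "\<zeta> \<noteq> 0" using that by auto
      moreover have "F (1 / \<zeta>^2) - F 0 = 1 / \<zeta>^2 * F1 (1 / \<zeta>^2)"
        using F1(2)[of "1 / \<zeta>^2"] inb[OF that] by simp
      ultimately show ?thesis
        using qsq[OF inb[OF that]] by (simp add: power_mult_distrib)
    qed
    have "F1 0 / (F (1 / \<zeta>^2) - F 0) = F1 0 / (F (1 / \<xi>^2) - F 0)"
      using sq[OF z, unfolded eq] sq[OF x] by (rule trans[OF sym])
    then have "F (1 / \<zeta>^2) = F (1 / \<xi>^2)"
      using A by (metis divide_cancel_left eq_iff_diff_eq_0 diff_add_cancel)
    then have "1 / \<zeta>^2 = 1 / \<xi>^2"
      using inj_onD[OF inj] inb[OF z] inb[OF x] by blast
    with eq have "\<zeta> * q (1 / \<xi>^2) = \<xi> * q (1 / \<xi>^2)" by (simp only:)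
    then show "\<zeta> = \<xi>" by (simp only: mult_right_cancel[OF qnz])
  qed
  from area_theorem_first_coefficient[OF q q0 this]
  show ?thesis unfolding dq norm_mult by (simp add: mult_left_le)
qed

section \<open>The distortion theorem\<close>

lemma Moebius_function_has_derivative:
  assumes a: "cmod a < 1" and \<zeta>: "cmod \<zeta> < 1"
  shows "(Moebius_function 0 a has_field_derivative of_real (1 - (cmod a)^2) / (1 - cnj a * \<zeta>)^2) (at \<zeta>)"
proof -
  have k: "of_real (1 - (cmod a)^2) = 1 - a * cnj a" using complex_norm_square[of a] by simp
  have "1 - cnj a * \<zeta> \<noteq> 0"
  proof
    assume "1 - cnj a * \<zeta> = 0"
    then have "cmod (cnj a * \<zeta>) = 1" by simp
    moreover have "cmod (cnj a * \<zeta>) < 1 * 1"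
      by (rule norm_mult_less) (use a \<zeta> in auto)
    ultimately show False by simp
  qed
  then show ?thesis
    unfolding Moebius_function_simple[abs_def] k
    by (auto intro!: derivative_eq_intros simp: field_simps power2_eq_square)
qed

text \<open>
  Composing with the disc automorphism that moves \<open>0\<close> to \<open>z\<close> turns information about
  injective functions at the origin into information at \<open>z\<close>.
\<close>

lemma koebe_transform:
  assumes h: "h holomorphic_on ball 0 1" and inj: "inj_on h (ball 0 1)" and z: "z \<in> ball 0 1"
  defines "F \<equiv> \<lambda>\<zeta>. h (Moebius_function 0 (-z) \<zeta>)"
  shows "F holomorphic_on ball 0 1" "inj_on F (ball 0 1)"
    "deriv F 0 = deriv h z * of_real (1 - (cmod z)^2)"
    "deriv (deriv F) 0 = (deriv (deriv h) z * of_real (1 - (cmod z)^2) - 2 * cnj z * deriv h z) * of_real (1 - (cmod z)^2)"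
proof -
  let ?M = "Moebius_function 0 (-z)"
  have nz: "cmod z < 1" using z by simp
  have M1: "?M ` ball 0 1 \<subseteq> ball 0 1"
    using Moebius_function_norm_lt_1 nz by auto
  have Mhol: "?M holomorphic_on ball 0 1"
    using Moebius_function_holomorphic nz by simp
  show hol: "F holomorphic_on ball 0 1"
    using holomorphic_on_compose_gen[OF Mhol h] M1 by (auto simp: F_def o_def)
  show "inj_on F (ball 0 1)"
  proof (rule inj_onI)
    fix x y assume x: "x \<in> ball 0 1" and y: "y \<in> ball 0 1" and "F x = F y"
    moreover have "?M x \<in> ball 0 1" "?M y \<in> ball 0 1" using M1 x y by blast+
    ultimately have "?M x = ?M y" using inj_onD[OF inj] unfolding F_def by blast
    moreover have "Moebius_function 0 z (?M w) = w" if "w \<in> ball 0 1" for w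
      by (rule Moebius_function_compose) (use that nz in auto)
    ultimately show "x = y" using x y by metis
  qed
  define k where "k = complex_of_real (1 - (cmod z)^2)"
  have dM: "(?M has_field_derivative k / (1 + cnj z * \<zeta>)^2) (at \<zeta>)" if "\<zeta> \<in> ball 0 1" for \<zeta>
    using Moebius_function_has_derivative[of "-z" \<zeta>] nz that by (simp add: k_def)
  have dh: "(h has_field_derivative deriv h x) (at x)" if "x \<in> ball 0 1" for x
    using h that holomorphic_derivI open_ball by blast
  have dF: "(F has_field_derivative deriv h (?M \<zeta>) * (k / (1 + cnj z * \<zeta>)^2)) (at \<zeta>)" if "\<zeta> \<in> ball 0 1" for \<zeta>
  proof -
    have "?M \<zeta> \<in> ball 0 1" using M1 that by blast
    from DERIV_chain2[OF dh[OF this] dM[OF that]] show ?thesis unfolding F_def .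
  qed
  have M0: "?M 0 = z" by (simp add: Moebius_function_simple)
  show "deriv F 0 = deriv h z * of_real (1 - (cmod z)^2)"
    using DERIV_imp_deriv[OF dF[of 0]] by (simp add: M0 k_def)
  have ddh: "(deriv h has_field_derivative deriv (deriv h) z) (at (?M 0))"
    using holomorphic_derivI[OF holomorphic_deriv[OF h open_ball] open_ball z] by (simp add: M0)
  have d1: "((\<lambda>\<zeta>. deriv h (?M \<zeta>)) has_field_derivative deriv (deriv h) z * k) (at 0)"
    using DERIV_chain2[OF ddh dM[of 0]] by simp
  have d2: "((\<lambda>\<zeta>. k / (1 + cnj z * \<zeta>)^2) has_field_derivative - 2 * cnj z * k) (at 0)"
    by (auto intro!: derivative_eq_intros)
  have "((\<lambda>\<zeta>. deriv h (?M \<zeta>) * (k / (1 + cnj z * \<zeta>)^2)) has_field_derivative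
      deriv (deriv h) z * k * k + - 2 * cnj z * k * deriv h z) (at 0)"
    using DERIV_mult[OF d1 d2] by (simp add: M0)
  then have "(deriv F has_field_derivative deriv (deriv h) z * k * k + - 2 * cnj z * k * deriv h z) (at 0)"
    by (rule has_field_derivative_transform_within_open[OF _ open_ball, of _ _ _ 0 1])
      (use DERIV_imp_deriv[OF dF] in auto)
  from DERIV_imp_deriv[OF this]
  show "deriv (deriv F) 0 = (deriv (deriv h) z * of_real (1 - (cmod z)^2) - 2 * cnj z * deriv h z) * of_real (1 - (cmod z)^2)"
    unfolding k_def by (simp add: algebra_simps)
qed

lemma second_derivative_bound:
  assumes h: "h holomorphic_on ball 0 1" and inj: "inj_on h (ball 0 1)" and z: "z \<in> ball 0 1"
  shows "cmod (deriv (deriv h) z * of_real (1 - (cmod z)^2) - 2 * cnj z * deriv h z) \<le> 4 * cmod (deriv h z)"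
proof -
  have pos: "0 < 1 - (cmod z)^2" using z by (simp add: power_less_one_iff)
  note K = koebe_transform[OF h inj z]
  have "cmod (deriv (deriv h) z * of_real (1 - (cmod z)^2) - 2 * cnj z * deriv h z) * (1 - (cmod z)^2)
      \<le> 4 * cmod (deriv h z) * (1 - (cmod z)^2)"
    using bieberbach_second_coefficient[OF K(1,2)] pos unfolding K(3,4) norm_mult norm_of_real by simp
  then show ?thesis using pos by (simp only: mult_le_cancel_right_pos)
qed

text \<open>
  Integration of a radial bound for the derivative along the ray from \<open>0\<close> to \<open>z\<close>.
\<close>

lemma radial_growth:
  fixes f :: "complex \<Rightarrow> complex" and \<psi> \<psi>' :: "real \<Rightarrow> real"
  assumes f: "f holomorphic_on ball 0 1" and z: "z \<in> ball 0 1"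
    and \<psi>: "\<And>t. 0 \<le> t \<Longrightarrow> t < 1 \<Longrightarrow> (\<psi> has_real_derivative \<psi>' t) (at t)"
    and bnd: "\<And>w. w \<in> ball 0 1 \<Longrightarrow> cmod (deriv f w) \<le> \<psi>' (cmod w)"
  shows "cmod (f z - f 0) \<le> \<psi> (cmod z) - \<psi> 0"
proof (cases "z = 0")
  case False
  define r where "r = cmod z"
  define e where "e = z / of_real r"
  have r: "0 < r" "r < 1" using False z by (auto simp: r_def)
  have e: "cmod e = 1" "z = of_real r * e" using r by (auto simp: e_def r_def norm_divide)
  have inb: "of_real t * e \<in> ball 0 1" if "t \<in> {0..r}" for t
    using that r e by (simp add: norm_mult)
  have df: "((\<lambda>t. f (of_real t * e)) has_vector_derivative e * deriv f (of_real t * e)) (at t)" if "t \<in> {0..r}" for t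
  proof -
    have "((\<lambda>t. of_real t * e) has_vector_derivative e) (at t)"
      by (auto intro!: derivative_eq_intros)
    moreover have "(f has_field_derivative deriv f (of_real t * e)) (at (of_real t * e))"
      using f inb[OF that] holomorphic_derivI open_ball by blast
    ultimately show ?thesis
      using field_vector_diff_chain_at[of "\<lambda>t. of_real t * e" e t f] by (simp add: o_def)
  qed
  have "norm (f (of_real r * e) - f (of_real 0 * e)) \<le> \<psi> r - \<psi> 0"
  proof (rule differentiable_bound_general[OF r(1)])
    show "continuous_on {0..r} (\<lambda>t. f (of_real t * e))"
      by (intro continuous_at_imp_continuous_on ballI has_vector_derivative_continuous[OF df])
    show "continuous_on {0..r} \<psi>"
    proof (intro continuous_at_imp_continuous_on ballI)
      fix t assume "t \<in> {0..r}"
      then show "isCont \<psi> t" using DERIV_isCont[OF \<psi>[of t]] r by simp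
    qed
    fix t assume t: "0 < t" "t < r"
    show "((\<lambda>t. f (of_real t * e)) has_vector_derivative e * deriv f (of_real t * e)) (at t)"
      using df t by simp
    show "(\<psi> has_vector_derivative \<psi>' t) (at t)"
      using \<psi>[of t] t r by (simp add: has_real_derivative_iff_has_vector_derivative)
    show "norm (e * deriv f (of_real t * e)) \<le> \<psi>' t"
      using bnd[OF inb[of t]] t e by (simp add: norm_mult)
  qed
  then have "norm (f z - f 0) \<le> \<psi> r - \<psi> 0"
    by (simp only: e(2)[symmetric] of_real_0 mult_zero_left)
  then show ?thesis by (simp only: r_def)
qed simp

text \<open>
  The bound for \<open>h'' / h'\<close> is a radial bound for the derivative of a logarithm \<open>l\<close> of
  \<open>h'\<close>; integrating it along rays bounds \<open>ln |h'|\<close>.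
\<close>

lemma distortion_upper:
  assumes h: "h holomorphic_on ball 0 1" and inj: "inj_on h (ball 0 1)" and z: "z \<in> ball 0 1"
  shows "cmod (deriv h z) \<le> cmod (deriv h 0) * (1 + cmod z) / (1 - cmod z)^3"
proof -
  have h'nz: "deriv h w \<noteq> 0" if "w \<in> ball 0 1" for w
    using holomorphic_injective_imp_regular[OF h open_ball inj that] .
  obtain l where l: "l holomorphic_on ball 0 1" "\<And>w. w \<in> ball 0 1 \<Longrightarrow> deriv h w = exp (l w)"
    using holomorphic_disc_log[OF holomorphic_deriv[OF h open_ball] h'nz] by blast
  \<comment> \<open>The logarithm of \<open>(1 + t) / (1 - t)\<^sup>3\<close>.\<close>
  define \<psi> where "\<psi> = (\<lambda>t::real. ln (1 + t) - 3 * ln (1 - t))"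
  have "cmod (l z - l 0) \<le> \<psi> (cmod z) - \<psi> 0"
  proof (rule radial_growth[OF l(1) z])
    fix t :: real assume t: "0 \<le> t" "t < 1"
    have "1 - t^2 = (1 + t) * (1 - t)" by (simp add: power2_eq_square algebra_simps)
    moreover have "1 / (1 + t) + 3 / (1 - t) = (4 + 2 * t) / ((1 + t) * (1 - t))"
      using t by (simp add: field_simps)
    ultimately show "(\<psi> has_real_derivative (4 + 2 * t) / (1 - t^2)) (at t)"
      unfolding \<psi>_def using t by (auto intro!: derivative_eq_intros)
  next
    fix w :: complex assume w: "w \<in> ball 0 1"
    have pos: "0 < 1 - (cmod w)^2" using w by (simp add: power_less_one_iff)
    have "deriv (deriv h) w = deriv h w * deriv l w"
    proof (rule DERIV_imp_deriv)
      have "((\<lambda>w. exp (l w)) has_field_derivative deriv h w * deriv l w) (at w)"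
        using holomorphic_derivI[OF l(1) open_ball w] l(2)[OF w] by (auto intro!: derivative_eq_intros)
      then show "(deriv h has_field_derivative deriv h w * deriv l w) (at w)"
        by (rule has_field_derivative_transform_within_open[OF _ open_ball w]) (simp add: l(2))
    qed
    then have "deriv (deriv h) w * k - 2 * cnj w * deriv h w = deriv h w * (deriv l w * k - 2 * cnj w)" for k
      by (simp add: algebra_simps)
    from second_derivative_bound[OF h inj w, unfolded this norm_mult[of "deriv h w"]]
    have "cmod (deriv h w) * cmod (deriv l w * of_real (1 - (cmod w)^2) - 2 * cnj w) \<le> cmod (deriv h w) * 4"
      by (simp only: mult.commute[of 4])
    then have "cmod (deriv l w * of_real (1 - (cmod w)^2) - 2 * cnj w) \<le> 4"
      by (rule mult_left_le_imp_le) (use h'nz[OF w] in simp)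
    then have "cmod (deriv l w * of_real (1 - (cmod w)^2)) \<le> 4 + cmod (2 * cnj w)"
      using norm_triangle_sub[of "deriv l w * of_real (1 - (cmod w)^2)" "2 * cnj w"] by linarith
    then show "cmod (deriv l w) \<le> (4 + 2 * cmod w) / (1 - (cmod w)^2)"
      using pos by (simp add: norm_mult le_divide_eq del: of_real_diff)
  qed
  then have "Re (l z - l 0) \<le> \<psi> (cmod z)"
    using complex_Re_le_cmod[of "l z - l 0"] by (simp add: \<psi>_def)
  then have "exp (Re (l z - l 0)) \<le> exp (\<psi> (cmod z))" by simp
  also have "exp (\<psi> (cmod z)) = (1 + cmod z) / (1 - cmod z)^3"
  proof -
    have p: "0 < 1 + cmod z" "0 < 1 - cmod z" using z by (auto simp: add_pos_nonneg)
    have "exp (3 * ln (1 - cmod z)) = (1 - cmod z)^3"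
      using p exp_of_nat_mult[of 3 "ln (1 - cmod z)"] by simp
    then show ?thesis unfolding \<psi>_def exp_diff using p by simp
  qed
  finally have "cmod (deriv h 0) * exp (Re (l z - l 0)) \<le> cmod (deriv h 0) * ((1 + cmod z) / (1 - cmod z)^3)"
    by (intro mult_left_mono) auto
  moreover have "cmod (deriv h z) = cmod (deriv h 0) * exp (Re (l z - l 0))"
    using l(2)[OF z] l(2)[of 0] by (simp add: flip: exp_add)
  ultimately show ?thesis by simp
qed

lemma growth_upper:
  assumes h: "h holomorphic_on ball 0 1" and inj: "inj_on h (ball 0 1)" and z: "z \<in> ball 0 1"
  shows "cmod (h z - h 0) \<le> cmod (deriv h 0) * cmod z / (1 - cmod z)^2"
proof -
  define \<psi> where "\<psi> = (\<lambda>t. cmod (deriv h 0) * t / (1 - t)^2)"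
  have "cmod (h z - h 0) \<le> \<psi> (cmod z) - \<psi> 0"
  proof (rule radial_growth[OF h z _ distortion_upper[OF h inj]])
    fix t :: real assume t: "0 \<le> t" "t < 1"
    have eq: "(C * u^2 - C * (1 - u) * (- (2 * u))) / (u^2 * u^2) = C * (1 + (1 - u)) / u^3"
      if "u \<noteq> 0" for C u :: real
      using that by (simp add: field_simps eval_nat_numeral)
    have "(\<psi> has_real_derivative (cmod (deriv h 0) * (1 - t)^2 - cmod (deriv h 0) * t * (- (2 * (1 - t)))) / ((1 - t)^2 * (1 - t)^2)) (at t)"
      unfolding \<psi>_def by (rule DERIV_divide) (use t in \<open>auto intro!: derivative_eq_intros\<close>)
    then show "(\<psi> has_real_derivative cmod (deriv h 0) * (1 + t) / (1 - t)^3) (at t)"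
      using eq[of "1 - t" "cmod (deriv h 0)"] t by simp
  qed
  then show ?thesis by (simp add: \<psi>_def)
qed

text \<open>
  The growth theorem for the Koebe transform of \<open>h\<close> at \<open>z\<close>, evaluated at
  \<open>- z\<close>, which the disc automorphism sends back to \<open>0\<close>.
\<close>

lemma log_derivative_bound:
  assumes h: "h holomorphic_on ball 0 1" and inj: "inj_on h (ball 0 1)" and z: "z \<in> ball 0 1"
  shows "cmod (h z - h 0) \<le> cmod (deriv h z) * (cmod z * (1 + cmod z) / (1 - cmod z))"
proof -
  note K = koebe_transform[OF h inj z]
  have r: "cmod z < 1" using z by simp
  have "Moebius_function 0 (-z) (-z) = 0" "Moebius_function 0 (-z) 0 = z"
    by (simp_all add: Moebius_function_simple)
  moreover have "0 \<le> 1 - (cmod z)^2" using r by (simp add: power_le_one)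
  ultimately have "cmod (h 0 - h z) \<le> cmod (deriv h z) * (1 - (cmod z)^2) * cmod z / (1 - cmod z)^2"
    using growth_upper[OF K(1,2), of "-z"] r unfolding K(3) norm_mult norm_of_real by simp
  also have "(1 - (cmod z)^2) = (1 + cmod z) * (1 - cmod z)" by (simp add: power2_eq_square algebra_simps)
  also have "cmod (deriv h z) * ((1 + cmod z) * (1 - cmod z)) * cmod z / (1 - cmod z)^2 =
     cmod (deriv h z) * (cmod z * (1 + cmod z) / (1 - cmod z))"
  proof -
    have "C * (a * u) * t / u^2 = C * (t * a / u)" if "u \<noteq> 0" for C a u t :: real
      using that by (simp add: power2_eq_square)
    then show ?thesis using r by simp
  qed
  finally show ?thesis by (simp add: norm_minus_commute)
qed

section \<open>The radius of convexity\<close>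

text \<open>
  At a critical point the derivative increases through \<open>0\<close>, so the function is larger just to
  the right of it, and the point cannot be a maximum.
\<close>

lemma no_interior_maximum:
  fixes \<phi> \<phi>1 \<phi>2 :: "real \<Rightarrow> real"
  assumes d1: "\<And>s. s \<in> {0..1} \<Longrightarrow> (\<phi> has_real_derivative \<phi>1 s) (at s)"
    and d2: "\<And>s. s \<in> {0..1} \<Longrightarrow> (\<phi>1 has_real_derivative \<phi>2 s) (at s)"
    and crit: "\<And>s. s \<in> {0..1} \<Longrightarrow> \<phi>1 s = 0 \<Longrightarrow> 0 < \<phi>2 s"
    and s: "s \<in> {0..1}"
  shows "\<phi> s \<le> max (\<phi> 0) (\<phi> 1)"
proof -
  have "continuous_on {0..1} \<phi>"
    by (intro continuous_at_imp_continuous_on ballI DERIV_isCont[OF d1])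
  then obtain m where m: "m \<in> {0..1}" "\<And>x. x \<in> {0..1} \<Longrightarrow> \<phi> x \<le> \<phi> m"
    using continuous_attains_sup[of "{0..1}" \<phi>] by auto
  have "m = 0 \<or> m = 1"
  proof (rule ccontr)
    assume "\<not> (m = 0 \<or> m = 1)"
    then have m01: "0 < m" "m < 1" using m(1) by auto
    have "\<phi>1 m = 0"
    proof (rule DERIV_local_max[OF d1[OF m(1)]])
      show "0 < min m (1 - m)" using m01 by simp
      show "\<forall>y. \<bar>m - y\<bar> < min m (1 - m) \<longrightarrow> \<phi> y \<le> \<phi> m"
        using m(2) by (auto simp: abs_less_iff)
    qed
    then have "0 < \<phi>2 m" using crit[OF m(1)] by simp
    from DERIV_pos_inc_right[OF d2[OF m(1)] this]
    obtain d where d: "0 < d" "\<And>h. 0 < h \<Longrightarrow> h < d \<Longrightarrow> \<phi>1 m < \<phi>1 (m + h)" by blast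
    \<comment> \<open>To the right of a critical point with positive second derivative the function increases.\<close>
    define e where "e = min (d / 2) (1 - m)"
    have e: "0 < e" "e < d" "m + e \<le> 1" using d m01 by (auto simp: e_def)
    have "\<exists>x. m < x \<and> x < m + e \<and> \<phi> (m + e) - \<phi> m = (m + e - m) * \<phi>1 x"
    proof (rule MVT2)
      fix x assume "m \<le> x" "x \<le> m + e"
      then show "(\<phi> has_real_derivative \<phi>1 x) (at x)" using m01 e by (intro d1) auto
    qed (use e in simp)
    then obtain x where x: "m < x" "x < m + e" "\<phi> (m + e) - \<phi> m = e * \<phi>1 x" by auto
    have "0 < \<phi>1 x" using d(2)[of "x - m"] x e \<open>\<phi>1 m = 0\<close> by simp
    then have "\<phi> m < \<phi> (m + e)" using x e mult_pos_pos[of e "\<phi>1 x"] by linarith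
    moreover have "\<phi> (m + e) \<le> \<phi> m" using m01 e by (intro m(2)) auto
    ultimately show False by simp
  qed
  then show ?thesis using m(2)[OF s] by auto
qed

text \<open>
  A segment inside the image of \<open>h\<close> is pulled back to a curve by the holomorphic inverse of
  \<open>h\<close>.
\<close>

lemma segment_lift:
  assumes h: "h holomorphic_on ball 0 1" and inj: "inj_on h (ball 0 1)"
    and r: "r \<le> 1" and a: "a \<in> ball 0 r" and b: "b \<in> ball 0 r"
    and seg: "closed_segment (h a) (h b) \<subseteq> h ` ball 0 r"
  obtains \<zeta> :: "real \<Rightarrow> complex" where "\<zeta> 0 = a" "\<zeta> 1 = b"
    "\<And>s. s \<in> {0..1} \<Longrightarrow> \<zeta> s \<in> ball 0 r"
    "\<And>s. s \<in> {0..1} \<Longrightarrow> h (\<zeta> s) = h a + of_real s * (h b - h a)"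
    "\<And>s. s \<in> {0..1} \<Longrightarrow> (\<zeta> has_vector_derivative (h b - h a) / deriv h (\<zeta> s)) (at s)"
proof -
  obtain k where k: "k holomorphic_on h ` ball 0 1"
    and dk: "\<And>z. z \<in> ball 0 1 \<Longrightarrow> deriv h z * deriv k (h z) = 1"
    and kh: "\<And>z. z \<in> ball 0 1 \<Longrightarrow> k (h z) = z"
    using holomorphic_has_inverse[OF h open_ball inj] by metis
  have op: "open (h ` ball 0 1)" by (rule open_mapping_thm3[OF h open_ball inj])
  have sub: "ball 0 r \<subseteq> (ball 0 1 :: complex set)" using r by (rule subset_ball)
  define p where "p = (\<lambda>s. h a + of_real s * (h b - h a))"
  define \<zeta> where "\<zeta> = (\<lambda>s. k (p s))"
  have p: "p s \<in> h ` ball 0 r" if "s \<in> {0..1}" for s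
  proof -
    have "p s \<in> closed_segment (h a) (h b)"
      unfolding closed_segment_def p_def using that
      by (auto intro!: exI[of _ s] simp: scaleR_conv_of_real algebra_simps)
    then show ?thesis using seg by blast
  qed
  have \<zeta>: "\<zeta> s \<in> ball 0 r" "h (\<zeta> s) = p s" if s: "s \<in> {0..1}" for s
  proof -
    obtain z where z: "z \<in> ball 0 r" "p s = h z" using p[OF s] by blast
    moreover have "k (h z) = z" using kh z sub by blast
    ultimately show "\<zeta> s \<in> ball 0 r" "h (\<zeta> s) = p s" by (simp_all add: \<zeta>_def)
  qed
  have "(\<zeta> has_vector_derivative (h b - h a) / deriv h (\<zeta> s)) (at s)" if s: "s \<in> {0..1}" for s
  proof -
    have in1: "\<zeta> s \<in> ball 0 1" using \<zeta>(1)[OF s] sub by blast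
    then have ps: "p s \<in> h ` ball 0 1" using \<zeta>(2)[OF s] by (metis imageI)
    have "(p has_vector_derivative (h b - h a)) (at s)"
      unfolding p_def by (auto intro!: derivative_eq_intros)
    from field_vector_diff_chain_at[OF this holomorphic_derivI[OF k op ps]]
    have "(\<zeta> has_vector_derivative (h b - h a) * deriv k (p s)) (at s)"
      by (simp add: \<zeta>_def o_def)
    moreover have "deriv k (p s) = 1 / deriv h (\<zeta> s)"
      using dk[OF in1] \<zeta>(2)[OF s] by (metis nonzero_eq_divide_eq mult.commute mult_zero_left zero_neq_one)
    ultimately show ?thesis by simp
  qed
  moreover have "\<zeta> 0 = a" "\<zeta> 1 = b"
    using kh a b sub by (auto simp: \<zeta>_def p_def)
  ultimately show ?thesis using that \<zeta> unfolding p_def by blast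
qed

text \<open>
  Let \<open>\<zeta>\<close> be the lift of the segment, so that \<open>\<zeta>'' = - (h'' / h') \<zeta>'\<^sup>2\<close>. Where
  \<open>|\<zeta>|\<^sup>2\<close> is critical, \<open>\<zeta>'\<close> is tangent to a circle around \<open>0\<close>, say
  \<open>\<zeta>' = \<i> \<mu> \<zeta>\<close>, and the second derivative of \<open>|\<zeta>|\<^sup>2\<close> is
  \<open>2 \<mu>\<^sup>2 |\<zeta>|\<^sup>2 (1 + Re (\<zeta> h'' / h')) > 0\<close>. So \<open>|\<zeta>|\<close> is largest at an end
  point of the curve.
\<close>

lemma segment_stays_inside:
  assumes h: "h holomorphic_on ball 0 1" and inj: "inj_on h (ball 0 1)"
    and r: "r \<le> 1" and R: "R < r" and a: "a \<in> cball 0 R" and b: "b \<in> cball 0 R"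
    and conv: "\<And>z. z \<in> ball 0 r \<Longrightarrow> 0 < 1 + Re (z * deriv (deriv h) z / deriv h z)"
    and seg: "closed_segment (h a) (h b) \<subseteq> h ` ball 0 r"
  shows "closed_segment (h a) (h b) \<subseteq> h ` cball 0 R"
proof (cases "a = b")
  case True
  then show ?thesis using a by auto
next
  case False
  have ab: "a \<in> ball 0 r" "b \<in> ball 0 r" using a b R by auto
  have sub: "ball 0 r \<subseteq> (ball 0 1 :: complex set)" using r by (rule subset_ball)
  define c where "c = h b - h a"
  have c: "c \<noteq> 0"
  proof
    assume "c = 0"
    then have "h a = h b" by (simp add: c_def)
    then show False using inj_onD[OF inj] ab sub False by blast
  qed
  obtain \<zeta> where \<zeta>0: "\<zeta> 0 = a" and \<zeta>1: "\<zeta> 1 = b"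
    and \<zeta>r: "\<And>s. s \<in> {0..1} \<Longrightarrow> \<zeta> s \<in> ball 0 r"
    and h\<zeta>: "\<And>s. s \<in> {0..1} \<Longrightarrow> h (\<zeta> s) = h a + of_real s * c"
    and d\<zeta>: "\<And>s. s \<in> {0..1} \<Longrightarrow> (\<zeta> has_vector_derivative c / deriv h (\<zeta> s)) (at s)"
    by (rule segment_lift[OF h inj r ab seg, folded c_def]) (rule that)
  define P where "P = (\<lambda>z. deriv (deriv h) z / deriv h z)"
  define \<zeta>' where "\<zeta>' = (\<lambda>s. c / deriv h (\<zeta> s))"
  define \<zeta>'' where "\<zeta>'' = (\<lambda>s. - P (\<zeta> s) * (\<zeta>' s)^2)"
  have nz: "deriv h (\<zeta> s) \<noteq> 0" if "s \<in> {0..1}" for s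
    using holomorphic_injective_imp_regular[OF h open_ball inj] \<zeta>r[OF that] sub by blast
  have d1: "(\<zeta> has_vector_derivative \<zeta>' s) (at s)" if "s \<in> {0..1}" for s
    using d\<zeta>[OF that] by (simp add: \<zeta>'_def)
  have d2: "(\<zeta>' has_vector_derivative \<zeta>'' s) (at s)" if s: "s \<in> {0..1}" for s
  proof -
    have "\<zeta> s \<in> ball 0 1" using \<zeta>r[OF s] sub by blast
    then have "(deriv h has_field_derivative deriv (deriv h) (\<zeta> s)) (at (\<zeta> s))"
      using holomorphic_derivI[OF holomorphic_deriv[OF h open_ball] open_ball] by blast
    then have "((\<lambda>z. c / deriv h z) has_field_derivative - c * deriv (deriv h) (\<zeta> s) / (deriv h (\<zeta> s))^2) (at (\<zeta> s))"
      using nz[OF s] by (auto intro!: derivative_eq_intros simp: power2_eq_square)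
    from field_vector_diff_chain_at[OF d1[OF s] this] show ?thesis
      using nz[OF s] by (simp add: \<zeta>'_def \<zeta>''_def P_def o_def power2_eq_square mult_ac)
  qed
  define \<phi> where "\<phi> = (\<lambda>s. \<zeta> s \<bullet> \<zeta> s)"
  define \<phi>1 where "\<phi>1 = (\<lambda>s. \<zeta> s \<bullet> \<zeta>' s + \<zeta>' s \<bullet> \<zeta> s)"
  define \<phi>2 where "\<phi>2 = (\<lambda>s. (\<zeta> s \<bullet> \<zeta>'' s + \<zeta>' s \<bullet> \<zeta>' s) + (\<zeta>' s \<bullet> \<zeta>' s + \<zeta>'' s \<bullet> \<zeta> s))"
  note inner_deriv = bounded_bilinear.has_vector_derivative[OF bounded_bilinear_inner]
  have bound: "\<phi> s \<le> max (\<phi> 0) (\<phi> 1)" if "s \<in> {0..1}" for s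
  proof (rule no_interior_maximum[OF _ _ _ that])
    fix s :: real assume s: "s \<in> {0..1}"
    show "(\<phi> has_real_derivative \<phi>1 s) (at s)"
      unfolding \<phi>_def \<phi>1_def has_real_derivative_iff_has_vector_derivative
      by (rule inner_deriv[OF d1[OF s] d1[OF s]])
    show "(\<phi>1 has_real_derivative \<phi>2 s) (at s)"
      unfolding \<phi>1_def \<phi>2_def has_real_derivative_iff_has_vector_derivative
      by (intro has_vector_derivative_add inner_deriv d1 d2 s)
    assume "\<phi>1 s = 0"
    then have orth: "Re (\<zeta>' s * cnj (\<zeta> s)) = 0"
      by (simp add: \<phi>1_def inner_complex_def algebra_simps)
    have \<zeta>'nz: "\<zeta>' s \<noteq> 0" using c nz[OF s] by (simp add: \<zeta>'_def)
    show "0 < \<phi>2 s"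
    proof (cases "\<zeta> s = 0")
      case True
      then show ?thesis using \<zeta>'nz by (simp add: \<phi>2_def)
    next
      case False
      define \<mu> where "\<mu> = Im (\<zeta>' s / \<zeta> s)"
      have "Re (\<zeta>' s / \<zeta> s) = 0"
        using orth by (simp add: complex_div_cnj[of "\<zeta>' s"])
      then have "\<zeta>' s / \<zeta> s = \<i> * of_real \<mu>" by (simp add: complex_eq_iff \<mu>_def)
      then have \<zeta>'s: "\<zeta>' s = \<i> * of_real \<mu> * \<zeta> s" using False by (simp add: field_simps)
      then have "\<mu> \<noteq> 0" using \<zeta>'nz by auto
      have Re_scale: "Re (of_real x * w) = x * Re w" for x w by simp
      have "\<zeta>'' s = of_real (\<mu>^2) * (\<zeta> s * (\<zeta> s * P (\<zeta> s)))"
        unfolding \<zeta>''_def \<zeta>'s by (simp add: power2_eq_square algebra_simps)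
      then have "\<zeta> s \<bullet> \<zeta>'' s = \<mu>^2 * Re (cnj (\<zeta> s) * (\<zeta> s * (\<zeta> s * P (\<zeta> s))))"
        by (simp add: inner_complex_def algebra_simps)
      also have "cnj (\<zeta> s) * (\<zeta> s * (\<zeta> s * P (\<zeta> s))) = of_real ((cmod (\<zeta> s))^2) * (\<zeta> s * P (\<zeta> s))"
        unfolding complex_norm_square by (simp add: algebra_simps)
      finally have "\<zeta> s \<bullet> \<zeta>'' s = \<mu>^2 * ((cmod (\<zeta> s))^2 * Re (\<zeta> s * P (\<zeta> s)))"
        by (simp only: Re_scale)
      moreover have "\<zeta>' s \<bullet> \<zeta>' s = \<mu>^2 * (cmod (\<zeta> s))^2"
        unfolding \<zeta>'s power2_norm_eq_inner[symmetric] by (simp add: norm_mult power_mult_distrib)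
      moreover have "\<phi>2 s = 2 * (\<zeta> s \<bullet> \<zeta>'' s + \<zeta>' s \<bullet> \<zeta>' s)"
        unfolding \<phi>2_def inner_commute[of "\<zeta>'' s"] by argo
      ultimately have "\<phi>2 s = 2 * (\<mu>^2 * ((cmod (\<zeta> s))^2 * (1 + Re (\<zeta> s * P (\<zeta> s)))))"
        by (simp only: distrib_left mult_1_right add.commute)
      moreover have "0 < 1 + Re (\<zeta> s * P (\<zeta> s))"
        using conv[OF \<zeta>r[OF s]] by (simp add: P_def)
      ultimately show ?thesis using False \<open>\<mu> \<noteq> 0\<close> by simp
    qed
  qed
  show ?thesis
  proof
    fix x assume "x \<in> closed_segment (h a) (h b)"
    then obtain s where s: "s \<in> {0..1}" "x = (1 - s) *\<^sub>R h a + s *\<^sub>R h b"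
      by (auto simp: closed_segment_def)
    then have "x = h a + of_real s * c"
      by (simp add: c_def scaleR_conv_of_real algebra_simps)
    then have "x = h (\<zeta> s)" by (simp only: h\<zeta>[OF s(1)])
    have sq: "(cmod (\<zeta> s))^2 \<le> R^2"
    proof -
      have "(cmod a)^2 \<le> R^2" "(cmod b)^2 \<le> R^2" using a b by (auto intro: power_mono)
      then show ?thesis using bound[OF s(1)] by (simp add: \<phi>_def \<zeta>0 \<zeta>1 power2_norm_eq_inner)
    qed
    have "0 \<le> R" using order_trans[OF norm_ge_zero, of a R] a by simp
    with sq have "cmod (\<zeta> s) \<le> R" by (rule power2_le_imp_le)
    with \<open>x = h (\<zeta> s)\<close> show "x \<in> h ` cball 0 R" by auto
  qed
qed

text \<open>
  The analytic criterion for convexity. For \<open>a\<close>, \<open>b\<close> in the disc, consider the segments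
  from \<open>h (t a)\<close> to \<open>h (t b)\<close> for \<open>t\<close> from \<open>0\<close> to \<open>1\<close>. The
  parameters \<open>t\<close> whose segment lies in the image of the open disc form an open set. By the previous
  lemma they are also those whose segment lies in the image of a fixed smaller closed disc, so they
  form a closed set. As \<open>t = 0\<close> is among them, all of \<open>[0, 1]\<close> is.
\<close>

theorem convex_image_disc:
  assumes h: "h holomorphic_on ball 0 1" and inj: "inj_on h (ball 0 1)" and r: "r \<le> 1"
    and conv: "\<And>z. z \<in> ball 0 r \<Longrightarrow> 0 < 1 + Re (z * deriv (deriv h) z / deriv h z)"
  shows "convex (h ` ball 0 r)"
  unfolding convex_contains_segment
proof (intro ballI)
  fix x y assume "x \<in> h ` ball 0 r" "y \<in> h ` ball 0 r"
  then obtain a b where a: "a \<in> ball 0 r" "x = h a" and b: "b \<in> ball 0 r" "y = h b" by blast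
  define R where "R = max (cmod a) (cmod b)"
  have R: "R < r" using a b by (simp add: R_def)
  have sub: "ball 0 r \<subseteq> (ball 0 1 :: complex set)" using r by (rule subset_ball)
  have scaled: "of_real t * a \<in> cball 0 R" "of_real t * b \<in> cball 0 R" if "t \<in> {0..1}" for t :: real
    using that mult_left_le_one_le[of "cmod a" t] mult_left_le_one_le[of "cmod b" t]
    by (auto simp: norm_mult R_def)
  have cballR: "cball 0 R \<subseteq> (ball 0 r :: complex set)" using R by auto
  define V where "V = h ` ball 0 r"
  define K where "K = h ` cball 0 R"
  have hol: "h holomorphic_on ball 0 r" "h holomorphic_on cball 0 R"
    using h holomorphic_on_subset sub cballR by blast+
  have "open V"
    unfolding V_def using open_mapping_thm3[OF hol(1) open_ball] inj inj_on_subset sub by blast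
  have "compact K"
    unfolding K_def by (intro compact_continuous_image holomorphic_on_imp_continuous_on hol) simp
  have KV: "K \<subseteq> V" unfolding K_def V_def using cballR by blast
  \<comment> \<open>The point with parameter \<open>s\<close> on the segment belonging to \<open>t\<close>.\<close>
  define Q where "Q = (\<lambda>p :: real \<times> real. (1 - of_real (snd p)) * h (of_real (fst p) * a) + of_real (snd p) * h (of_real (fst p) * b))"
  define I where "I = ({0..1} :: real set)"
  have contQ: "continuous_on (I \<times> I) Q"
  proof -
    have "continuous_on (I \<times> I) (\<lambda>p. h (of_real (fst p) * v))" if "v = a \<or> v = b" for v
      by (rule continuous_on_compose2[OF holomorphic_on_imp_continuous_on[OF hol(2)]])
        (use that scaled in \<open>auto simp: I_def intro!: continuous_intros\<close>)
    then show ?thesis unfolding Q_def by (intro continuous_intros) auto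
  qed
  have seg: "closed_segment (h (of_real t * a)) (h (of_real t * b)) = (\<lambda>s. Q (t, s)) ` I" for t
    by (auto simp: closed_segment_def Q_def I_def scaleR_conv_of_real image_iff)
  have step: "(\<forall>s\<in>I. Q (t, s) \<in> V) \<longleftrightarrow> (\<forall>s\<in>I. Q (t, s) \<in> K)" if t: "t \<in> I" for t
  proof
    assume "\<forall>s\<in>I. Q (t, s) \<in> V"
    then have "closed_segment (h (of_real t * a)) (h (of_real t * b)) \<subseteq> h ` ball 0 r"
      unfolding seg V_def by blast
    then have "closed_segment (h (of_real t * a)) (h (of_real t * b)) \<subseteq> K"
      unfolding K_def using segment_stays_inside[OF h inj r R scaled conv] t unfolding I_def by blast
    then show "\<forall>s\<in>I. Q (t, s) \<in> K" unfolding seg by blast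
  qed (use KV in blast)
  define T where "T = {t \<in> I. \<forall>s\<in>I. Q (t, s) \<in> V}"
  have "closed T"
  proof -
    have "T = {t \<in> I. \<forall>s\<in>I. Q (t, s) \<in> K}" unfolding T_def using step by blast
    moreover have "0 \<in> I" by (simp add: I_def)
    ultimately have "T = (\<Inter>s\<in>I. I \<inter> (\<lambda>t. Q (t, s)) -` K)" by blast
    moreover have "closed (I \<inter> (\<lambda>t. Q (t, s)) -` K)" if "s \<in> I" for s
    proof (rule continuous_closed_preimage)
      show "continuous_on I (\<lambda>t. Q (t, s))"
        by (rule continuous_on_compose2[OF contQ]) (use that in \<open>auto intro!: continuous_intros\<close>)
    qed (use \<open>compact K\<close> in \<open>auto simp: I_def compact_imp_closed\<close>)
    then have "closed (\<Inter>s\<in>I. I \<inter> (\<lambda>t. Q (t, s)) -` K)" by (intro closed_INT ballI)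
    ultimately show ?thesis by (simp only:)
  qed
  moreover have "closed (I - T)"
  proof -
    \<comment> \<open>The complement is the projection of a compact set.\<close>
    have "I - T = fst ` ((I \<times> I) \<inter> Q -` (- V))"
      by (force simp: T_def image_iff)
    moreover have "compact ((I \<times> I) \<inter> Q -` (- V))"
    proof -
      have "closed (I \<times> I)" by (simp add: I_def closed_Times)
      then have "closed ((I \<times> I) \<inter> Q -` (- V))"
        by (intro continuous_closed_preimage[OF contQ]) (use \<open>open V\<close> in auto)
      moreover have "compact (I \<times> I)" by (simp add: I_def compact_Times)
      ultimately show ?thesis by (metis closed_Int_compact inf.idem inf.left_idem inf_commute)
    qed
    then have "compact (fst ` ((I \<times> I) \<inter> Q -` (- V)))"
      by (intro compact_continuous_image continuous_intros)
    ultimately show ?thesis by (simp add: compact_imp_closed)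
  qed
  moreover have "connected I" by (simp add: I_def)
  moreover have "0 \<in> T"
  proof -
    have "0 \<in> ball (0::complex) r" using a by (auto intro: le_less_trans[OF norm_ge_zero])
    then have "h 0 \<in> V" unfolding V_def by blast
    then show ?thesis by (simp add: T_def I_def Q_def algebra_simps)
  qed
  ultimately have "I \<subseteq> T"
    using connected_closedD[of I T "I - T"] by (auto simp: T_def)
  then have "1 \<in> T" by (auto simp: I_def)
  then have "closed_segment (h (of_real 1 * a)) (h (of_real 1 * b)) \<subseteq> V"
    unfolding seg T_def by blast
  then show "closed_segment x y \<subseteq> h ` ball 0 r" by (simp add: a b V_def)
qed

lemma two_minus_sqrt3_quadratic:
  assumes "0 \<le> r" "r < 2 - sqrt 3"
  shows "0 < 1 - 4 * r + r^2" "r < 1"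
proof -
  have "sqrt 3 < 2 - r" using assms by simp
  then have "(sqrt 3)^2 < (2 - r)^2" by (intro power_strict_mono) auto
  then show "0 < 1 - 4 * r + r^2" by (simp add: power2_eq_square algebra_simps)
  have "1 < sqrt 3" by simp
  then show "r < 1" using assms by linarith
qed

text \<open>
  With \<open>r = |z|\<close>, the bound for the second derivative gives
  \<open>(1 - r\<^sup>2) (1 + Re (z h'' / h')) \<ge> 1 - 4 r + r\<^sup>2\<close>, and \<open>2 - sqrt 3\<close> is the
  smaller root of the right-hand side.
\<close>

theorem radius_of_convexity:
  assumes h: "h holomorphic_on ball 0 1" and inj: "inj_on h (ball 0 1)"
  shows "convex (h ` ball 0 (2 - sqrt 3))"
proof (rule convex_image_disc[OF h inj])
  have "1 \<le> sqrt (3::real)" by simp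
  then show le1: "2 - sqrt 3 \<le> 1" by linarith
  fix z :: complex assume z: "z \<in> ball 0 (2 - sqrt 3)"
  define r where "r = cmod z"
  have r: "0 \<le> r" "r < 2 - sqrt 3" using z by (auto simp: r_def)
  note q = two_minus_sqrt3_quadratic[OF r]
  have z1: "z \<in> ball 0 1" using q by (simp add: r_def)
  have nz: "deriv h z \<noteq> 0" using holomorphic_injective_imp_regular[OF h open_ball inj z1] .
  define P where "P = deriv (deriv h) z / deriv h z"
  have "deriv (deriv h) z * k - 2 * cnj z * deriv h z = deriv h z * (P * k - 2 * cnj z)" for k
    using nz by (simp add: P_def algebra_simps)
  from second_derivative_bound[OF h inj z1, unfolded this norm_mult[of "deriv h z"]]
  have "cmod (deriv h z) * cmod (P * of_real (1 - r^2) - 2 * cnj z) \<le> cmod (deriv h z) * 4"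
    by (simp only: mult.commute[of 4] r_def)
  then have "cmod (P * of_real (1 - r^2) - 2 * cnj z) \<le> 4"
    by (rule mult_left_le_imp_le) (use nz in simp)
  then have "r * cmod (P * of_real (1 - r^2) - 2 * cnj z) \<le> r * 4"
    using r by (intro mult_left_mono) auto
  then have "cmod (z * (P * of_real (1 - r^2) - 2 * cnj z)) \<le> 4 * r"
    by (simp only: norm_mult[of z] r_def mult.commute)
  then have "- (4 * r) \<le> Re (z * (P * of_real (1 - r^2) - 2 * cnj z))"
    using abs_Re_le_cmod[of "z * (P * of_real (1 - r^2) - 2 * cnj z)"] by linarith
  also have "z * (P * of_real (1 - r^2) - 2 * cnj z) = z * P * of_real (1 - r^2) - of_real (2 * r^2)"
    using complex_norm_square[of z] by (simp add: r_def algebra_simps)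
  finally have "- (4 * r) \<le> Re (z * P) * (1 - r^2) - 2 * r^2"
    by (simp add: mult.commute)
  then have "0 < (1 + Re (z * P)) * (1 - r^2)"
    using q by (simp add: algebra_simps)
  moreover have "0 < 1 - r^2" using r q by (simp add: power_less_one_iff)
  ultimately have "0 < 1 + Re (z * P)" by (simp add: zero_less_mult_iff)
  then show "0 < 1 + Re (z * deriv (deriv h) z / deriv h z)" by (simp add: P_def)
qed

section \<open>Harmonic mappings with a bounded multiplier\<close>

lemma bounded_class_less_one:
  assumes w: "w \<in> bounded_class" and nu: "\<not> unimodular_constant w" and z: "z \<in> ball 0 1"
  shows "cmod (w z) < 1"
proof (rule ccontr)
  assume "\<not> cmod (w z) < 1"
  then have 1: "cmod (w z) = 1" using w z by (force simp: bounded_class_def)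
  have hol: "w holomorphic_on ball 0 1" using w by (simp add: bounded_class_def)
  have "w constant_on ball 0 1"
    by (rule maximum_modulus_principle[OF hol open_ball _ open_ball order_refl z])
       (use 1 w in \<open>auto simp: bounded_class_def\<close>)
  then have "unimodular_constant w"
    using 1 z unfolding constant_on_def unimodular_constant_def by metis
  then show False using nu by simp
qed

text \<open>
  The Schwarz lemma for \<open>w\<close> composed with disc automorphisms on both sides, chosen so that
  \<open>0\<close> is sent to \<open>z\<close> and then \<open>w z\<close> to \<open>0\<close>.
\<close>

lemma schwarz_pick_derivative:
  assumes w: "w holomorphic_on ball 0 1" and lt: "\<And>z. z \<in> ball 0 1 \<Longrightarrow> cmod (w z) < 1"
    and z: "z \<in> ball 0 1"
  shows "cmod (deriv w z) * (1 - (cmod z)^2) \<le> 1 - (cmod (w z))^2"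
proof -
  let ?M = "Moebius_function 0 (-z)" and ?N = "Moebius_function 0 (w z)"
  have nz: "cmod z < 1" and nw: "cmod (w z) < 1" using z lt by auto
  define u where "u = (\<lambda>\<zeta>. ?N (w (?M \<zeta>)))"
  have M1: "?M \<zeta> \<in> ball 0 1" if "\<zeta> \<in> ball 0 1" for \<zeta>
    using Moebius_function_norm_lt_1[of "-z" \<zeta>] nz that by simp
  have M0: "?M 0 = z" by (simp add: Moebius_function_simple)
  have du: "(u has_field_derivative (of_real (1 - (cmod (w z))^2) / (1 - cnj (w z) * w (?M \<zeta>))^2) *
      (deriv w (?M \<zeta>) * (of_real (1 - (cmod (-z))^2) / (1 - cnj (-z) * \<zeta>)^2))) (at \<zeta>)"
    if \<zeta>: "\<zeta> \<in> ball 0 1" for \<zeta>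
  proof -
    have dM: "(?M has_field_derivative of_real (1 - (cmod (-z))^2) / (1 - cnj (-z) * \<zeta>)^2) (at \<zeta>)"
      by (rule Moebius_function_has_derivative) (use nz \<zeta> in auto)
    have dN: "(?N has_field_derivative of_real (1 - (cmod (w z))^2) / (1 - cnj (w z) * w (?M \<zeta>))^2) (at (w (?M \<zeta>)))"
      by (rule Moebius_function_has_derivative[OF nw lt[OF M1[OF \<zeta>]]])
    have dw: "(w has_field_derivative deriv w (?M \<zeta>)) (at (?M \<zeta>))"
      using holomorphic_derivI[OF w open_ball M1[OF \<zeta>]] .
    show ?thesis unfolding u_def
      by (rule DERIV_chain2[where f = ?N and g = "\<lambda>\<zeta>. w (?M \<zeta>)", OF dN DERIV_chain2[where f = w and g = ?M, OF dw dM]])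
  qed
  have "u holomorphic_on ball 0 1"
    unfolding holomorphic_on_open[OF open_ball] using du by blast
  moreover have "u 0 = 0" by (simp add: u_def M0 Moebius_function_simple)
  moreover have "cmod (u \<zeta>) < 1" if "cmod \<zeta> < 1" for \<zeta>
    unfolding u_def using Moebius_function_norm_lt_1[OF nw] lt M1 that by simp
  ultimately have "cmod (deriv u 0) \<le> 1" using Schwarz_Lemma(2)[of u 0] by simp
  define A where "A = 1 - (cmod (w z))^2"
  have A: "0 < A" using nw by (simp add: A_def power_less_one_iff)
  have Aw: "1 - cnj (w z) * w z = of_real A"
    using complex_norm_square[of "w z"] by (simp add: A_def mult.commute)
  have B: "0 < 1 - (cmod z)^2" using nz by (simp add: power_less_one_iff)
  have "deriv u 0 = (of_real A / (of_real A)^2) * (deriv w z * of_real (1 - (cmod z)^2))"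
    using DERIV_imp_deriv[OF du[of 0]] by (simp add: M0 Aw A_def[symmetric])
  then have "cmod (deriv u 0) = (A / A^2) * (cmod (deriv w z) * (1 - (cmod z)^2))"
    using A B by (simp only: norm_mult norm_divide norm_power norm_of_real abs_of_pos)
  with \<open>cmod (deriv u 0) \<le> 1\<close> have "cmod (deriv w z) * (1 - (cmod z)^2) \<le> A"
    using A by (simp add: power2_eq_square divide_le_eq)
  then show ?thesis by (simp add: A_def)
qed

text \<open>
  From \<open>g' = w' h + w h'\<close>, the Schwarz-Pick bound for \<open>w'\<close> and the bound for
  \<open>h / h'\<close>, with \<open>a = |w z|\<close> and \<open>r = |z|\<close>,
  \<open>|g' / h'| \<le> (1 - a\<^sup>2) r / (1 - r)\<^sup>2 + a\<close>. The inequality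
  \<open>r / (1 - r)\<^sup>2 < 1 / 2\<close> is, for \<open>r < 1\<close>, the same as \<open>1 - 4 r + r\<^sup>2 > 0\<close>, and
  \<open>(1 - a\<^sup>2) / 2 + a \<le> 1\<close> always holds.
\<close>

lemma dilatation_less_one:
  assumes h: "h holomorphic_on ball 0 1" and inj: "inj_on h (ball 0 1)" and h0: "h 0 = 0"
    and w: "w \<in> bounded_class" and nu: "\<not> unimodular_constant w"
    and g: "\<And>z. z \<in> ball 0 1 \<Longrightarrow> g z = w z * h z"
    and z: "z \<in> ball 0 (2 - sqrt 3)"
  shows "cmod (deriv g z) < cmod (deriv h z)"
proof -
  define r where "r = cmod z"
  have r: "0 \<le> r" "r < 2 - sqrt 3" using z by (auto simp: r_def)
  note q = two_minus_sqrt3_quadratic[OF r]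
  have z1: "z \<in> ball 0 1" using q by (simp add: r_def)
  have whol: "w holomorphic_on ball 0 1" using w by (simp add: bounded_class_def)
  have lt: "cmod (w x) < 1" if "x \<in> ball 0 1" for x by (rule bounded_class_less_one[OF w nu that])
  define D where "D = cmod (deriv h z)"
  define a where "a = cmod (w z)"
  have D: "0 < D" using holomorphic_injective_imp_regular[OF h open_ball inj z1] by (simp add: D_def)
  have a: "0 \<le> a" "a < 1" using lt[OF z1] by (auto simp: a_def)
  have "deriv g z = deriv w z * h z + deriv h z * w z"
  proof (rule DERIV_imp_deriv)
    have "((\<lambda>z. w z * h z) has_field_derivative deriv w z * h z + deriv h z * w z) (at z)"
      using holomorphic_derivI[OF whol open_ball z1] holomorphic_derivI[OF h open_ball z1] by (rule DERIV_mult)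
    then show "(g has_field_derivative deriv w z * h z + deriv h z * w z) (at z)"
      by (rule has_field_derivative_transform_within_open[OF _ open_ball z1]) (simp add: g)
  qed
  then have "cmod (deriv g z) \<le> cmod (deriv w z) * cmod (h z) + D * a"
    using norm_triangle_ineq[of "deriv w z * h z" "deriv h z * w z"] by (simp add: norm_mult D_def a_def)
  also have "\<dots> < D"
  proof -
    have pos: "0 < 1 - r" "0 < 1 - r^2" using r q by (auto simp: power_less_one_iff)
    have 1: "cmod (deriv w z) \<le> (1 - a^2) / (1 - r^2)"
      using schwarz_pick_derivative[OF whol lt z1] pos by (simp add: a_def r_def le_divide_eq)
    have 2: "cmod (h z) \<le> D * (r * (1 + r) / (1 - r))"
      using log_derivative_bound[OF h inj z1] by (simp add: h0 D_def r_def)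
    have a2: "0 < 1 - a^2" using a by (simp add: power_less_one_iff)
    have "cmod (deriv w z) * cmod (h z) \<le> (1 - a^2) / (1 - r^2) * (D * (r * (1 + r) / (1 - r)))"
      using 1 2 a2 pos by (intro mult_mono) auto
    also have "\<dots> = D * (1 - a^2) * (r / (1 - r)^2)"
    proof -
      have fac: "1 - r^2 = (1 + r) * (1 - r)" by (simp add: power2_eq_square algebra_simps)
      have "x / (p * u) * (D * (r * p / u)) = D * x * (r / u^2)" if "p \<noteq> 0" "u \<noteq> 0" for x p u
        using that by (simp add: power2_eq_square)
      from this[of "1 + r" "1 - r" "1 - a^2"] show ?thesis unfolding fac using pos r by linarith
    qed
    also have "\<dots> < D * (1 - a^2) * (1 / 2)"
    proof (rule mult_strict_left_mono)
      have "2 * r < (1 - r)^2" using q by (simp add: power2_eq_square algebra_simps)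
      then show "r / (1 - r)^2 < 1 / 2" using pos by (simp add: divide_less_eq)
    qed (use D a2 in simp)
    finally have "cmod (deriv w z) * cmod (h z) + D * a < D * ((1 - a^2) / 2 + a)"
      by (simp add: algebra_simps)
    also have "\<dots> \<le> D * 1"
    proof (rule mult_left_mono)
      have "0 \<le> (1 - a)^2" by simp
      then have "2 * a \<le> 1 + a^2" by (simp add: power2_eq_square algebra_simps)
      then show "(1 - a^2) / 2 + a \<le> 1" by argo
    qed (use D in simp)
    finally show ?thesis by simp
  qed
  finally show ?thesis by (simp add: D_def)
qed

text \<open>
  In the coordinate \<open>u = h z\<close>, which ranges over a convex domain, \<open>f\<close> is
  \<open>u + cnj (G u)\<close> with \<open>|G'| < 1\<close>. Such a \<open>G\<close> shortens every segment strictly, so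
  \<open>cnj (G u)\<close> cannot compensate a difference of two values of \<open>u\<close>.
\<close>

lemma harmonic_injective_of_convex:
  assumes h: "h holomorphic_on ball 0 1" and inj: "inj_on h (ball 0 1)"
    and g: "g holomorphic_on ball 0 1" and r: "r \<le> 1" and conv: "convex (h ` ball 0 r)"
    and dil: "\<And>z. z \<in> ball 0 r \<Longrightarrow> cmod (deriv g z) < cmod (deriv h z)"
    and f: "\<And>z. z \<in> ball 0 r \<Longrightarrow> f z = h z + cnj (g z)"
  shows "inj_on f (ball 0 r)"
proof (rule inj_onI, rule ccontr)
  fix a b assume a: "a \<in> ball 0 r" and b: "b \<in> ball 0 r" and eq: "f a = f b" and "a \<noteq> b"
  have sub: "ball 0 r \<subseteq> (ball 0 1 :: complex set)" using r by (rule subset_ball)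
  define c where "c = h b - h a"
  have c: "c \<noteq> 0"
  proof
    assume "c = 0"
    then have "h a = h b" by (simp add: c_def)
    then show False using inj_onD[OF inj] a b sub \<open>a \<noteq> b\<close> by blast
  qed
  have "closed_segment (h a) (h b) \<subseteq> h ` ball 0 r"
    using conv a b by (simp add: convex_contains_segment)
  from segment_lift[OF h inj r a b this, folded c_def]
  obtain \<zeta> where \<zeta>01: "\<zeta> 0 = a" "\<zeta> 1 = b"
    and \<zeta>r: "\<And>s. s \<in> {0..1} \<Longrightarrow> \<zeta> s \<in> ball 0 r"
    and d\<zeta>: "\<And>s. s \<in> {0..1} \<Longrightarrow> (\<zeta> has_vector_derivative c / deriv h (\<zeta> s)) (at s)"
    by blast
  define \<Gamma>' where "\<Gamma>' = (\<lambda>s. c / deriv h (\<zeta> s) * deriv g (\<zeta> s))"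
  have d\<Gamma>: "((\<lambda>s. g (\<zeta> s)) has_vector_derivative \<Gamma>' s) (at s)" if s: "s \<in> {0..1}" for s
  proof -
    have "\<zeta> s \<in> ball 0 1" using \<zeta>r[OF s] sub by blast
    from field_vector_diff_chain_at[OF d\<zeta>[OF s] holomorphic_derivI[OF g open_ball this]]
    show ?thesis by (simp only: \<Gamma>'_def o_def)
  qed
  have "\<exists>x\<in>{0<..<1}. norm (g (\<zeta> 1) - g (\<zeta> 0)) \<le> norm ((1 - 0) *\<^sub>R \<Gamma>' x)"
  proof (rule mvt_general)
    show "continuous_on {0..1} (\<lambda>s. g (\<zeta> s))"
      by (intro continuous_at_imp_continuous_on ballI has_vector_derivative_continuous[OF d\<Gamma>])
    show "((\<lambda>s. g (\<zeta> s)) has_derivative (\<lambda>t. t *\<^sub>R \<Gamma>' x)) (at x)" if "0 < x" "x < 1" for x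
      using d\<Gamma>[of x] that by (simp add: has_vector_derivative_def)
  qed simp
  then obtain x where "x \<in> {0<..<1}" "cmod (g b - g a) \<le> cmod (\<Gamma>' x)"
    by (auto simp: \<zeta>01)
  then have x: "x \<in> {0..1}" "cmod (g b - g a) \<le> cmod (\<Gamma>' x)" by auto
  have "cmod (\<Gamma>' x) < cmod c"
  proof -
    have "cmod (deriv g (\<zeta> x)) < cmod (deriv h (\<zeta> x))" by (rule dil[OF \<zeta>r[OF x(1)]])
    moreover from this have "0 < cmod (deriv h (\<zeta> x))" using norm_ge_zero le_less_trans by blast
    ultimately show ?thesis
      using c by (simp add: \<Gamma>'_def norm_mult norm_divide divide_less_eq mult.commute)
  qed
  moreover have "cmod (g b - g a) = cmod c"
  proof -
    have "c = cnj (g a - g b)" using eq f[OF a] f[OF b] by (simp add: c_def algebra_simps)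
    then show ?thesis by (metis complex_mod_cnj norm_minus_commute)
  qed
  ultimately show False using x by simp
qed

section \<open>Sharpness\<close>

text \<open>
  The expression is the modulus of \<open>g' / h'\<close> at \<open>- r\<close> in the extremal example below. It
  exceeds \<open>1\<close> exactly when \<open>(1 + a) r (1 + r) > (1 + a r) (1 - r)\<^sup>2\<close>. At
  \<open>a = 1\<close> this reads \<open>2 r > (1 - r)\<^sup>2\<close>, that is \<open>r > 2 - sqrt 3\<close>, and it
  persists for \<open>a\<close> slightly below \<open>1\<close>.
\<close>

lemma mobius_dilatation_exceeds_one:
  fixes r :: real
  assumes r: "2 - sqrt 3 < r" "r < 1"
  obtains a where "0 < a" "a < 1"
    "1 \<le> (r + a) / (1 + a * r) + (1 - a^2) / (1 + a * r)^2 * (r * (1 + r) / (1 - r))"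
proof -
  have "1 \<le> sqrt (3::real)" "sqrt 3 \<le> sqrt (4::real)" by (simp, intro real_sqrt_le_mono, simp)
  moreover have "sqrt (4::real) = 2" by simp
  ultimately have r0: "0 < r" using r by linarith
  have "(2 - r)^2 < (sqrt 3)^2"
    using r r0 by (intro power_strict_mono) auto
  then have "(1 - r)^2 < 2 * r" by (simp add: power2_eq_square algebra_simps)
  then have gt: "(1 + 1 * r) * (1 - r)^2 < (1 + 1) * (r * (1 + r))"
    using r0 mult_strict_left_mono[of "(1-r)^2" "2 * r" "1 + r"] by (simp add: algebra_simps)
  have "((\<lambda>a. (1 + a) * (r * (1 + r)) - (1 + a * r) * (1 - r)^2) \<longlongrightarrow> (1 + 1) * (r * (1 + r)) - (1 + 1 * r) * (1 - r)^2) (at_left 1)"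
    by (intro tendsto_intros)
  then have "eventually (\<lambda>a. 0 < (1 + a) * (r * (1 + r)) - (1 + a * r) * (1 - r)^2) (at_left 1)"
    by (rule order_tendstoD(1)) (use gt in simp)
  moreover have "eventually (\<lambda>a::real. a \<in> {0<..<1}) (at_left 1)"
    by (rule eventually_at_left_real) simp
  ultimately have "eventually (\<lambda>a. 0 < (1 + a) * (r * (1 + r)) - (1 + a * r) * (1 - r)^2 \<and> a \<in> {0<..<1}) (at_left 1)"
    by (rule eventually_conj)
  then obtain a where a: "0 < (1 + a) * (r * (1 + r)) - (1 + a * r) * (1 - r)^2" "a \<in> {0<..<1}"
    using eventually_happens trivial_limit_at_left_real by blast
  define p where "p = 1 + a * r"
  have p: "0 < p" using a r0 by (simp add: p_def add_pos_pos)
  have "1 - (r + a) / p = (1 - a) * (1 - r) / p"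
    using p by (simp add: p_def field_simps)
  also have "\<dots> \<le> (1 - a^2) / p^2 * (r * (1 + r) / (1 - r))"
  proof -
    have "(1 - a) * (1 - r) / p = (1 - a) / (p^2 * (1 - r)) * (p * (1 - r)^2)"
      using p r by (simp add: power2_eq_square)
    also have "\<dots> \<le> (1 - a) / (p^2 * (1 - r)) * ((1 + a) * (r * (1 + r)))"
      using a p r by (intro mult_left_mono) (auto simp: p_def)
    also have "\<dots> = (1 - a^2) / p^2 * (r * (1 + r) / (1 - r))"
    proof -
      have "1 - a^2 = (1 - a) * (1 + a)" by (simp add: power2_eq_square algebra_simps)
      then show ?thesis by simp
    qed
    finally show ?thesis .
  qed
  finally show ?thesis using that[of a] a by (auto simp: p_def)
qed

lemma koebe_holomorphic: "(\<lambda>z. z / (1 - z)^2) holomorphic_on ball 0 1"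
  by (intro holomorphic_intros) auto

lemma koebe_inj: "inj_on (\<lambda>z::complex. z / (1 - z)^2) (ball 0 1)"
proof (rule inj_onI)
  fix x y :: complex assume x: "x \<in> ball 0 1" and y: "y \<in> ball 0 1"
    and eq: "x / (1 - x)^2 = y / (1 - y)^2"
  have ne: "1 - x \<noteq> 0" "1 - y \<noteq> 0" using x y by auto
  have "(x - y) * (1 - x * y) = x * (1 - y)^2 - y * (1 - x)^2"
    by (simp add: power2_eq_square algebra_simps)
  also have "\<dots> = 0" using eq ne by (simp add: frac_eq_eq)
  finally have "x = y \<or> x * y = 1" by simp
  moreover have "cmod (x * y) < 1 * 1" by (rule norm_mult_less) (use x y in auto)
  ultimately show "x = y" by auto
qed

lemma koebe_deriv:
  assumes "z \<noteq> (1::complex)"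
  shows "((\<lambda>z. z / (1 - z)^2) has_field_derivative (1 + z) / (1 - z)^3) (at z)"
proof -
  have "((\<lambda>z. z / (1 - z)^2) has_field_derivative (1 * (1 - z)^2 - z * (- (2 * (1 - z)))) / ((1 - z)^2 * (1 - z)^2)) (at z)"
    by (rule DERIV_divide) (use assms in \<open>auto intro!: derivative_eq_intros\<close>)
  moreover have "(1 * u^2 - (1 - u) * (- (2 * u))) / (u^2 * u^2) = (1 + (1 - u)) / u^3" if "u \<noteq> 0" for u :: complex
    using that by (simp add: field_simps eval_nat_numeral)
  from this[of "1 - z"] have "(1 * (1 - z)^2 - z * (- (2 * (1 - z)))) / ((1 - z)^2 * (1 - z)^2) = (1 + z) / (1 - z)^3"
    using assms by simp
  ultimately show ?thesis by (simp only:)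
qed

text \<open>
  The Koebe function \<open>h\<close> attains the bound for \<open>|h / h'|\<close> at \<open>- \<rho>\<close>, the disc automorphism
  \<open>w\<close> attains equality in the Schwarz-Pick bound, and at \<open>- \<rho>\<close> the terms \<open>w\<close> and
  \<open>w' h / h'\<close> are both negative, so that their moduli add up.
\<close>

lemma sharpness:
  fixes r :: real
  assumes r: "2 - sqrt 3 < r" "r \<le> 1"
  shows "\<exists>f h g w. Har_rep f h g \<and> inj_on h unit_disc \<and>
               w \<in> bounded_class \<and> \<not> unimodular_constant w \<and>
               (\<forall>z\<in>unit_disc. g z = w z * h z) \<and> \<not> sense_preserving_on (ball 0 r) h g"
proof -
  obtain \<rho> where \<rho>: "2 - sqrt 3 < \<rho>" "\<rho> < r" using dense[OF r(1)] by blast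
  have \<rho>1: "\<rho> < 1" using \<rho> r by simp
  have "sqrt (3::real) < sqrt 4" by (intro real_sqrt_less_mono) simp
  then have \<rho>0: "0 < \<rho>" using \<rho> by simp
  obtain a where a: "0 < a" "a < 1"
    and big: "1 \<le> (\<rho> + a) / (1 + a * \<rho>) + (1 - a^2) / (1 + a * \<rho>)^2 * (\<rho> * (1 + \<rho>) / (1 - \<rho>))"
    by (rule mobius_dilatation_exceeds_one[OF \<rho>(1) \<rho>1]) (rule that)
  define h where "h = (\<lambda>z::complex. z / (1 - z)^2)"
  define w where "w = Moebius_function 0 (complex_of_real a)"
  define g where "g = (\<lambda>z. w z * h z)"
  define f where "f = (\<lambda>z. h z + cnj (g z))"
  have na: "cmod (complex_of_real a) < 1" using a by simp
  have hhol: "h holomorphic_on ball 0 1" unfolding h_def by (rule koebe_holomorphic)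
  have whol: "w holomorphic_on ball 0 1" unfolding w_def by (rule Moebius_function_holomorphic[OF na])
  have wlt: "cmod (w z) < 1" if "z \<in> ball 0 1" for z
    unfolding w_def using Moebius_function_norm_lt_1[OF na] that by simp
  have "Har_rep f h g"
    unfolding Har_rep_def
  proof (intro conjI)
    show "g holomorphic_on ball 0 1" unfolding g_def by (intro holomorphic_intros whol hhol)
    show "deriv h 0 = 1" unfolding h_def using DERIV_imp_deriv[OF koebe_deriv[of 0]] by simp
  qed (use hhol in \<open>auto simp: h_def g_def f_def\<close>)
  moreover have "inj_on h unit_disc" unfolding h_def by (rule koebe_inj)
  moreover have "w \<in> bounded_class" using whol wlt by (force simp: bounded_class_def)
  moreover have "\<not> unimodular_constant w"
  proof
    assume "unimodular_constant w"
    then obtain c where "cmod c = 1" "w 0 = c" unfolding unimodular_constant_def by force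
    then show False using wlt[of 0] by simp
  qed
  moreover have "\<not> sense_preserving_on (ball 0 r) h g"
  proof -
    define z where "z = complex_of_real (- \<rho>)"
    have z: "z \<in> ball 0 1" "z \<in> ball 0 r" using \<rho> \<rho>0 \<rho>1 by (auto simp: z_def)
    have z1: "z \<noteq> 1" using z by auto
    have dh: "(h has_field_derivative (1 + z) / (1 - z)^3) (at z)"
      unfolding h_def by (rule koebe_deriv[OF z1])
    define w' where "w' = of_real (1 - (cmod (complex_of_real a))^2) / (1 - cnj (complex_of_real a) * z)^2"
    have dw: "(w has_field_derivative w') (at z)"
      unfolding w_def w'_def by (rule Moebius_function_has_derivative[OF na]) (use z in simp)
    have dg: "deriv g z = w' * h z + (1 + z) / (1 - z)^3 * w z"
      unfolding g_def by (rule DERIV_imp_deriv[OF DERIV_mult[OF dw dh]])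
    have hz: "h z = (1 + z) / (1 - z)^3 * of_real (- (\<rho> * (1 + \<rho>) / (1 - \<rho>)))"
    proof -
      have "x / p^2 = u / p^3 * (x * p / u)" if "p \<noteq> 0" "u \<noteq> 0" for x p u :: complex
        using that by (simp add: eval_nat_numeral)
      moreover have "1 + z \<noteq> 0" using z by (metis add.inverse_inverse add_eq_0_iff mem_ball_0 norm_minus_cancel norm_one order_less_irrefl)
      ultimately have "h z = (1 + z) / (1 - z)^3 * (z * (1 - z) / (1 + z))"
        unfolding h_def using z1 by simp
      then show ?thesis by (simp add: z_def)
    qed
    have wz: "w z = - of_real ((\<rho> + a) / (1 + a * \<rho>))"
      by (simp add: w_def z_def Moebius_function_simple minus_divide_left)
    have w'z: "w' = of_real ((1 - a^2) / (1 + a * \<rho>)^2)"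
      by (simp add: w'_def z_def)
    have "deriv g z = - (deriv h z * of_real ((\<rho> + a) / (1 + a * \<rho>) + (1 - a^2) / (1 + a * \<rho>)^2 * (\<rho> * (1 + \<rho>) / (1 - \<rho>))))"
    proof -
      have "x * (d * - y) + d * - v = - (d * (v + x * y))" for d x y v :: complex
        by (simp add: algebra_simps)
      then show ?thesis
        unfolding dg hz wz w'z DERIV_imp_deriv[OF dh] of_real_add of_real_mult of_real_minus .
    qed
    then have "cmod (deriv g z) = cmod (deriv h z) * \<bar>(\<rho> + a) / (1 + a * \<rho>) + (1 - a^2) / (1 + a * \<rho>)^2 * (\<rho> * (1 + \<rho>) / (1 - \<rho>))\<bar>"
      by (simp only: norm_minus_cancel norm_mult norm_of_real)
    moreover have "cmod (deriv h z) * 1 \<le> cmod (deriv h z) * \<bar>(\<rho> + a) / (1 + a * \<rho>) + (1 - a^2) / (1 + a * \<rho>)^2 * (\<rho> * (1 + \<rho>) / (1 - \<rho>))\<bar>"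
      using big by (intro mult_left_mono) auto
    ultimately have "(cmod (deriv h z))^2 \<le> (cmod (deriv g z))^2" by (intro power_mono) auto
    then have "\<not> harmonic_jacobian h g z > 0" unfolding harmonic_jacobian_def by linarith
    then show ?thesis using z(2) unfolding sense_preserving_on_def by blast
  qed
  ultimately show ?thesis unfolding g_def by blast
qed

theorem theorem2p2:
  shows "(\<forall>f h g w.
            Har_rep f h g \<and> inj_on h unit_disc \<and>
            w \<in> bounded_class \<and> \<not> unimodular_constant w \<and>
            (\<forall>z\<in>unit_disc. g z = w z * h z) \<longrightarrow>
            sense_preserving_on (ball 0 (2 - sqrt 3)) h g \<and> inj_on f (ball 0 (2 - sqrt 3)))
       \<and> (\<forall>r::real. 2 - sqrt 3 < r \<and> r \<le> 1 \<longrightarrow>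
            (\<exists>f h g w.
               Har_rep f h g \<and> inj_on h unit_disc \<and>
               w \<in> bounded_class \<and> \<not> unimodular_constant w \<and>
               (\<forall>z\<in>unit_disc. g z = w z * h z) \<and>
               \<not> (sense_preserving_on (ball 0 r) h g \<and> inj_on f (ball 0 r))))"
proof (intro conjI allI impI)
  fix f h g w
  assume *: "Har_rep f h g \<and> inj_on h unit_disc \<and>
            w \<in> bounded_class \<and> \<not> unimodular_constant w \<and>
            (\<forall>z\<in>unit_disc. g z = w z * h z)"
  then have h: "h holomorphic_on unit_disc" and g: "g holomorphic_on unit_disc" and h0: "h 0 = 0"
    and f: "\<And>z. z \<in> unit_disc \<Longrightarrow> f z = h z + cnj (g z)"
    and inj: "inj_on h unit_disc" and w: "w \<in> bounded_class" and nu: "\<not> unimodular_constant w"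
    and gw: "\<And>z. z \<in> unit_disc \<Longrightarrow> g z = w z * h z"
    unfolding Har_rep_def by blast+
  have "1 \<le> sqrt (3::real)" by simp
  then have le1: "2 - sqrt 3 \<le> (1::real)" by linarith
  note dil = dilatation_less_one[OF h inj h0 w nu gw]
  show "sense_preserving_on (ball 0 (2 - sqrt 3)) h g"
    unfolding sense_preserving_on_def harmonic_jacobian_def
    using dil by (auto intro!: power_strict_mono)
  show "inj_on f (ball 0 (2 - sqrt 3))"
  proof (rule harmonic_injective_of_convex[OF h inj g le1 radius_of_convexity[OF h inj] dil])
    fix z :: complex assume "z \<in> ball 0 (2 - sqrt 3)"
    then show "f z = h z + cnj (g z)" using f subset_ball[OF le1] by blast
  qed
next
  fix r :: real assume "2 - sqrt 3 < r \<and> r \<le> 1"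
  then show "\<exists>f h g w. Har_rep f h g \<and> inj_on h unit_disc \<and>
               w \<in> bounded_class \<and> \<not> unimodular_constant w \<and>
               (\<forall>z\<in>unit_disc. g z = w z * h z) \<and>
               \<not> (sense_preserving_on (ball 0 r) h g \<and> inj_on f (ball 0 r))"
    using sharpness[of r] by blast
qed

end
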